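(* Let $k$ be a field, $R=k[x_1,\ldots,x_d]$ a polynomial ring, and $I\subseteq R$ a square-free monomial ideal. Then for every $m\in\mathbb Z_{>0}$ the natural maps $$\mathcal R^s(I)\to \mathcal R^s(I)^{1/m}\qquad\text{and}\qquad \operatorname{gr}^s_I(R)\to \operatorname{gr}^s_I(R)^{1/m},$$ induced by the inclusions $I^{(n)}\subseteq (I^{(nm)})^{1/m}$ for $n\geq 0$, split, as maps of $\mathcal R^s(I)$-modules and of $\operatorname{gr}^s_I(R)$-modules respectively.
   Context: For $n\in\mathbb Z_{>0}$, the $n$-th symbolic power of $I$ is $I^{(n)}=\bigcap_{\mathfrak p\in \operatorname{Min}(R/I)} (I^nR_{\mathfrak p}\cap R)$, where $\operatorname{Min}(R/I)$ is the set of minimal primes of $I$; $I^{(0)}=R$. Let $t$ be an extra variable and $A=k[x_1,\ldots,x_d,t]$. For $m\in\mathbb Z_{>0}$ set $R^{1/m}=k[x_1^{1/m},\ldots,x_d^{1/m}]\supseteq R$ and $A^{1/m}=k[x_1^{1/m},\ldots,x_d^{1/m},t^{1/m}]\supseteq A$. For a monomial ideal $J\subseteq R$, $J^{1/m}$ is the ideal of $R^{1/m}$ generated by $\{f^{1/m}\mid f\in J \text{ a monomial}\}$, where $(x_1^{a_1}\cdots x_d^{a_d})^{1/m}=x_1^{a_1/m}\cdots x_d^{a_d/m}$; for a square-free monomial ideal $I$ one has $I^{(n)}\subseteq (I^{(nm)})^{1/m}$. The symbolic Rees algebra of $I$ is $\mathcal R^s(I)=\bigoplus_{n\geq 0}I^{(n)}t^n\subseteq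 A$, and the symbolic associated graded algebra is $\operatorname{gr}^s_I(R)=\bigoplus_{n\geq 0}I^{(n)}/I^{(n+1)}=\mathcal R^s(I)/\mathcal J^s(I)$, where $\mathcal J^s(I)=\bigoplus_{n\geq 0}I^{(n+1)}t^n\subseteq \mathcal R^s(I)$. Their rings of $m$-roots are $\mathcal R^s(I)^{1/m}=\bigoplus_{n\geq 0}(I^{(n)})^{1/m}t^{n/m}\subseteq A^{1/m}$ and $\operatorname{gr}^s_I(R)^{1/m}=\mathcal R^s(I)^{1/m}/\mathcal J^s(I)^{1/m}$, where $\mathcal J^s(I)^{1/m}=\bigoplus_{n\geq 0}(I^{(n+1)})^{1/m}t^{n/m}$. A ring map $S\to T$ splits if it has an $S$-linear left inverse $T\to S$. *)

theory Defs
  imports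
    "HOL-Algebra.Algebra"
    "HOL-Algebra.Algebraic_Closure_Type"
    "HOL-Computational_Algebra.Fraction_Field"
    "HOL-Library.Poly_Mapping"
begin

text \<open>
  All polynomial rings of the statement are subrings of one ambient ring, the monoid algebra over
  \<open>k\<close> of the finitely supported rational exponent vectors. Index \<open>0\<close> is the
  extra variable \<open>t\<close>, and index \<open>i\<close> with \<open>1 \<le> i \<le> d\<close> is
  \<open>x\<^sub>i\<close>. The inclusions of \<open>R\<close> in \<open>R\<^sup>1\<^sup>/\<^sup>m\<close> and of
  \<open>A\<close> in \<open>A\<^sup>1\<^sup>/\<^sup>m\<close> are then inclusions of sets.
\<close>

type_synonym 'k frac_poly = "(nat \<Rightarrow>\<^sub>0 rat) \<Rightarrow>\<^sub>0 'k"

definition monomial :: "(nat \<Rightarrow>\<^sub>0 rat) \<Rightarrow> 'k::field frac_poly" where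
  "monomial a = Poly_Mapping.single a 1"

definition t_pow :: "rat \<Rightarrow> 'k::field frac_poly" where
  "t_pow q = monomial (Poly_Mapping.single 0 q)"

definition root_poly_ring :: "nat \<Rightarrow> nat set \<Rightarrow> 'k::field frac_poly ring" where
  "root_poly_ring m V = ring_of_type_algebra
     \<lparr>carrier := {f. \<forall>a\<in>Poly_Mapping.keys f. Poly_Mapping.keys a \<subseteq> V
                      \<and> (\<forall>i. of_nat m * Poly_Mapping.lookup a i \<in> \<nat>)}\<rparr>"

abbreviation R_root :: "nat \<Rightarrow> nat \<Rightarrow> 'k::field frac_poly ring" where
  "R_root d m \<equiv> root_poly_ring m {1..d}"

abbreviation A_root :: "nat \<Rightarrow> nat \<Rightarrow> 'k::field frac_poly ring" where
  "A_root d m \<equiv> root_poly_ring m {0..d}"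

abbreviation R_poly :: "nat \<Rightarrow> 'k::field frac_poly ring" where
  "R_poly d \<equiv> R_root d 1"

abbreviation A_poly :: "nat \<Rightarrow> 'k::field frac_poly ring" where
  "A_poly d \<equiv> A_root d 1"

definition squarefree_monomial_ideal :: "nat \<Rightarrow> 'k::field frac_poly set \<Rightarrow> bool" where
  "squarefree_monomial_ideal d I \<longleftrightarrow>
     (\<exists>E. (\<forall>a\<in>E. Poly_Mapping.keys a \<subseteq> {1..d} \<and> (\<forall>i. Poly_Mapping.lookup a i \<in> {0, 1}))
        \<and> I = genideal (R_poly d) (monomial ` E))"

text \<open>The elements of \<open>Min(R/I)\<close> are given as primes of \<open>R\<close> containing \<open>I\<close>.\<close>

definition minimal_primes :: "('a, 'b) ring_scheme \<Rightarrow> 'a set \<Rightarrow> 'a set set" where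
  "minimal_primes R I = {p. primeideal p R \<and> I \<subseteq> p
     \<and> (\<forall>q. primeideal q R \<and> I \<subseteq> q \<and> q \<subseteq> p \<longrightarrow> q = p)}"

text \<open>
  For a subring \<open>S\<close> of a domain and a prime \<open>p\<close> of \<open>S\<close>, the
  localization \<open>S\<^sub>p\<close> is realized inside the fraction field of the domain.
\<close>

definition localization_at :: "'a::idom set \<Rightarrow> 'a set \<Rightarrow> 'a fract ring" where
  "localization_at S p = ring_of_type_algebra
     \<lparr>carrier := {Fract a s |a s. a \<in> S \<and> s \<in> S - p}\<rparr>"

definition local_contraction :: "'a::idom set \<Rightarrow> 'a set \<Rightarrow> 'a set \<Rightarrow> 'a set" where
  "local_contraction S p J =
     {f \<in> S. Fract f 1 \<in> genideal (localization_at S p) ((\<lambda>a. Fract a 1) ` J)}"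

text \<open>
  Intersecting with the carrier makes the empty intersection, which occurs only for \<open>I = R\<close>,
  equal to \<open>R\<close>.
\<close>

definition symbolic_power ::
    "nat \<Rightarrow> 'k::field frac_poly set \<Rightarrow> nat \<Rightarrow> 'k frac_poly set" where
  "symbolic_power d I n =
     (if n = 0 then carrier (R_poly d)
      else carrier (R_poly d) \<inter>
        (\<Inter>p\<in>minimal_primes (R_poly d) I.
           local_contraction (carrier (R_poly d)) p (I [^]\<^bsub>ideals_set (R_poly d)\<^esub> n)))"

definition ideal_root ::
    "nat \<Rightarrow> nat \<Rightarrow> 'k::field frac_poly set \<Rightarrow> 'k frac_poly set" where
  "ideal_root d m J = genideal (R_root d m)
     {monomial (Poly_Mapping.map (\<lambda>q. q / of_nat m) a) |a. monomial a \<in> J}"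

text \<open>The internal direct sum of the \<open>L n t\<^sup>n\<^sup>/\<^sup>m\<close> over all \<open>n \<ge> 0\<close>.\<close>

definition graded_sum ::
    "nat \<Rightarrow> (nat \<Rightarrow> 'k::field frac_poly set) \<Rightarrow> 'k frac_poly set" where
  "graded_sum m L =
     {(\<Sum>n<N. f n * t_pow (of_nat n / of_nat m)) |f N. \<forall>n<N. f n \<in> L n}"

definition sym_rees :: "nat \<Rightarrow> 'k::field frac_poly set \<Rightarrow> 'k frac_poly ring" where
  "sym_rees d I = (A_poly d)\<lparr>carrier := graded_sum 1 (symbolic_power d I)\<rparr>"

definition sym_J :: "nat \<Rightarrow> 'k::field frac_poly set \<Rightarrow> 'k frac_poly set" where
  "sym_J d I = graded_sum 1 (\<lambda>n. symbolic_power d I (n + 1))"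

definition sym_gr :: "nat \<Rightarrow> 'k::field frac_poly set \<Rightarrow> 'k frac_poly set ring" where
  "sym_gr d I = sym_rees d I Quot sym_J d I"

definition sym_rees_root ::
    "nat \<Rightarrow> nat \<Rightarrow> 'k::field frac_poly set \<Rightarrow> 'k frac_poly ring" where
  "sym_rees_root d m I =
     (A_root d m)\<lparr>carrier := graded_sum m (\<lambda>n. ideal_root d m (symbolic_power d I n))\<rparr>"

definition sym_J_root ::
    "nat \<Rightarrow> nat \<Rightarrow> 'k::field frac_poly set \<Rightarrow> 'k frac_poly set" where
  "sym_J_root d m I = graded_sum m (\<lambda>n. ideal_root d m (symbolic_power d I (n + 1)))"

definition sym_gr_root ::
    "nat \<Rightarrow> nat \<Rightarrow> 'k::field frac_poly set \<Rightarrow> 'k frac_poly set ring" where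
  "sym_gr_root d m I = sym_rees_root d m I Quot sym_J_root d m I"

text \<open>
  In degree \<open>n\<close>, the inclusion of \<open>I\<^sup>(\<^sup>n\<^sup>)\<close> in
  \<open>(I\<^sup>(\<^sup>n\<^sup>m\<^sup>))\<^sup>1\<^sup>/\<^sup>m\<close> sends \<open>f t\<^sup>n\<close> to \<open>f t\<^sup>n\<^sup>m\<^sup>/\<^sup>m\<close>,
  which is the same element of the ambient ring.
\<close>

definition sym_rees_map :: "'k::field frac_poly \<Rightarrow> 'k frac_poly" where
  "sym_rees_map f = f"

text \<open>
  On a coset \<open>C = sym_J d I + g\<close> the union is the single coset \<open>sym_J_root d m I + g\<close>,
  because \<open>sym_J d I \<subseteq> sym_J_root d m I\<close>.
\<close>

definition sym_gr_map ::
    "nat \<Rightarrow> nat \<Rightarrow> 'k::field frac_poly set \<Rightarrow> 'k frac_poly set \<Rightarrow> 'k frac_poly set" where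
  "sym_gr_map d m I C = (\<Union>f\<in>C. sym_J_root d m I +>\<^bsub>sym_rees_root d m I\<^esub> f)"

definition ring_map_splits ::
    "('a, 'c) ring_scheme \<Rightarrow> ('b, 'e) ring_scheme \<Rightarrow> ('a \<Rightarrow> 'b) \<Rightarrow> bool" where
  "ring_map_splits S T \<phi> \<longleftrightarrow> ring_hom_cring S T \<phi>
     \<and> (\<exists>\<psi>. \<psi> \<in> carrier T \<rightarrow> carrier S
          \<and> (\<forall>u\<in>carrier T. \<forall>v\<in>carrier T. \<psi> (u \<oplus>\<^bsub>T\<^esub> v) = \<psi> u \<oplus>\<^bsub>S\<^esub> \<psi> v)
          \<and> (\<forall>s\<in>carrier S. \<forall>u\<in>carrier T. \<psi> (\<phi> s \<otimes>\<^bsub>T\<^esub> u) = s \<otimes>\<^bsub>S\<^esub> \<psi> u)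
          \<and> (\<forall>s\<in>carrier S. \<psi> (\<phi> s) = s))"

end

theory Submission
  imports Defs
begin

text \<open>
  The minimal primes of \<open>I\<close> are generated by sets \<open>P\<close> of variables, and \<open>I\<^sup>(\<^sup>n\<^sup>)\<close> is the
  intersection of their \<open>n\<close>-th powers. Hence all the algebras and ideals are spanned by monomials:
  in degree \<open>n\<close> the conditions on the exponent vector \<open>a\<close> are \<open>(\<Sum>i\<in>P. a\<^sub>i) \<ge> n\<close>, up to a shift
  by one for the ideals and a factor \<open>m\<close> for the rings of \<open>m\<close>-roots. The splitting discards the
  monomials with a non-integral exponent. It is linear because a product with an integral monomial
  is integral only if the other factor is, and it lands in the right place because dividing an
  inequality between multiples of \<open>m\<close> by \<open>m\<close>, or rounding \<open>m u + 1 \<le> m v\<close> to \<open>u + 1 \<le> v\<close>, gives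
  back the conditions over the original ring.
\<close>

section \<open>Polynomials with prescribed support\<close>

abbreviation keys where "keys \<equiv> Poly_Mapping.keys"
abbreviation lookup where "lookup \<equiv> Poly_Mapping.lookup"
abbreviation single where "single \<equiv> Poly_Mapping.single"

definition supported :: "'a set \<Rightarrow> ('a \<Rightarrow>\<^sub>0 'b::zero) set" where
  "supported S = {f. keys f \<subseteq> S}"

text \<open>Discarding the terms with exponent outside \<open>S\<close> will be the splitting, with
  \<open>S\<close> the exponents of the ring without roots. It is additive for every
  \<open>S\<close>; linearity is where the structure of \<open>S\<close> enters.\<close>

lift_definition keep :: "'a set \<Rightarrow> ('a \<Rightarrow>\<^sub>0 'b::zero) \<Rightarrow> 'a \<Rightarrow>\<^sub>0 'b"
  is "\<lambda>S f a. f a when a \<in> S"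
  by (erule finite_subset[rotated]) (auto simp: when_def)

lemma keys_keep: "keys (keep S f) = keys f \<inter> S"
  by transfer (auto simp: when_def)

lemma keep_in_supported: "keep S f \<in> supported S"
  by (simp add: supported_def keys_keep)

lemma keep_supported: "f \<in> supported S \<Longrightarrow> keep S f = f"
  unfolding supported_def by transfer (force simp: when_def)

lemma keep_supported_Compl: "f \<in> supported (- S) \<Longrightarrow> keep S f = 0"
  unfolding supported_def by transfer (force simp: when_def)

lemma keep_add: "keep S (f + g) = keep S f + keep S (g :: 'a \<Rightarrow>\<^sub>0 'b::monoid_add)"
  by transfer (auto simp: when_def)

lemma keep_diff: "keep S (f - g) = keep S f - keep S (g :: 'a \<Rightarrow>\<^sub>0 'b::ab_group_add)"
  by transfer (auto simp: when_def)

lemma keep_Compl: "keep S f + keep (- S) f = (f :: 'a \<Rightarrow>\<^sub>0 'b::monoid_add)"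
  by transfer (auto simp: when_def)

lemma supported_mono: "S \<subseteq> T \<Longrightarrow> supported S \<subseteq> supported T"
  by (auto simp: supported_def)

lemma zero_in_supported [simp]: "0 \<in> supported S"
  by (simp add: supported_def)

lemma single_in_supported: "a \<in> S \<Longrightarrow> single a c \<in> supported S"
  by (simp add: supported_def)

lemma one_in_supported: "0 \<in> S \<Longrightarrow> (1 :: 'a::zero \<Rightarrow>\<^sub>0 'b::zero_neq_one) \<in> supported S"
  by (simp add: supported_def)

lemma add_in_supported:
  "f \<in> supported S \<Longrightarrow> g \<in> supported S \<Longrightarrow> f + g \<in> supported S"
  for f g :: "'a \<Rightarrow>\<^sub>0 'b::monoid_add"
  using Poly_Mapping.keys_add[of f g] by (auto simp: supported_def)

lemma uminus_in_supported:
  "f \<in> supported S \<Longrightarrow> - f \<in> supported S" for f :: "'a \<Rightarrow>\<^sub>0 'b::ab_group_add"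
  by (auto simp: supported_def in_keys_iff)

lemma diff_in_supported:
  "f \<in> supported S \<Longrightarrow> g \<in> supported S \<Longrightarrow> f - g \<in> supported S"
  for f g :: "'a \<Rightarrow>\<^sub>0 'b::ab_group_add"
  using add_in_supported[of f S "- g"] by (simp add: uminus_in_supported)

lemma mult_in_supported:
  fixes f g :: "'a::comm_monoid_add \<Rightarrow>\<^sub>0 'b::semiring_0"
  assumes "f \<in> supported S" "g \<in> supported T" "\<And>a b. a \<in> S \<Longrightarrow> b \<in> T \<Longrightarrow> a + b \<in> U"
  shows "f * g \<in> supported U"
  using Poly_Mapping.keys_mult[of f g] assms unfolding supported_def by blast

lemma sum_in_supported:
  fixes F :: "'c \<Rightarrow> 'a \<Rightarrow>\<^sub>0 'b::comm_monoid_add"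
  assumes "\<And>i. i \<in> N \<Longrightarrow> F i \<in> supported S"
  shows "sum F N \<in> supported S"
  using assms by (induction N rule: infinite_finite_induct) (auto intro: add_in_supported)

lemma sum_single: "(\<Sum>a\<in>keys f. single a (lookup f a)) = f"
  for f :: "'a \<Rightarrow>\<^sub>0 'b::comm_monoid_add"
proof (rule poly_mapping_eqI)
  fix k
  have "lookup (\<Sum>a\<in>keys f. single a (lookup f a)) k = (\<Sum>a\<in>keys f. if a = k then lookup f k else 0)"
    by (auto simp: lookup_sum lookup_single when_def intro!: sum.cong)
  then show "lookup (\<Sum>a\<in>keys f. single a (lookup f a)) k = lookup f k"
    by (simp add: in_keys_iff)
qed

text \<open>Split \<open>g\<close> into its parts inside and outside \<open>A\<close>. The first
  part times \<open>f\<close> stays over \<open>A\<close> by closure under addition. The second part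
  times \<open>f\<close> has no exponent in \<open>A\<close> by the cancellation hypothesis, so
  truncation kills it.\<close>

lemma keep_mult:
  fixes f g :: "'a::comm_monoid_add \<Rightarrow>\<^sub>0 'b::semiring_0"
  assumes "f \<in> supported A" "g \<in> supported B"
    and "\<And>a b. a \<in> A \<Longrightarrow> b \<in> A \<Longrightarrow> a + b \<in> A"
    and "\<And>a b. a \<in> A \<Longrightarrow> b \<in> B \<Longrightarrow> a + b \<in> A \<Longrightarrow> b \<in> A"
  shows "keep A (f * g) = f * keep A g"
proof -
  have "keep A (f * g) = keep A (f * keep A g) + keep A (f * keep (- A) g)"
    by (simp flip: keep_add distrib_left add: keep_Compl)
  moreover have "f * keep A g \<in> supported A"
    using assms(1) keep_in_supported by (rule mult_in_supported) (rule assms(3))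
  moreover have "keep (- A) g \<in> supported (B - A)"
    using assms(2) by (auto simp: supported_def keys_keep)
  with assms(1) have "f * keep (- A) g \<in> supported (- A)"
    by (rule mult_in_supported) (use assms(4) in blast)
  ultimately show ?thesis
    by (simp add: keep_supported keep_supported_Compl)
qed

text \<open>The product of the initial forms of \<open>f\<close> and \<open>g\<close> with respect to the grading \<open>w\<close> is
  nonzero, and no other term of \<open>f * g\<close> can cancel it.\<close>

lemma minimal_degree_mult:
  fixes f g :: "'a::{ordered_cancel_comm_monoid_add,linorder} \<Rightarrow>\<^sub>0 'b::idom"
    and w :: "'a \<Rightarrow> rat"
  assumes w: "\<And>a b. w (a + b) = w a + w b" and "f \<noteq> 0" "g \<noteq> 0"
  obtains a b where "a \<in> keys f" "b \<in> keys g" "a + b \<in> keys (f * g)"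
    "\<forall>a'\<in>keys f. w a \<le> w a'" "\<forall>b'\<in>keys g. w b \<le> w b'"
proof -
  \<comment> \<open>The initial form collects the terms of least weight, which exists because a
    nonzero element has a finite nonempty set of exponents.\<close>
  have initial: "\<exists>\<alpha>. (\<forall>a\<in>keys h. \<alpha> \<le> w a) \<and> keep {a. w a = \<alpha>} h \<noteq> 0"
    if "h \<noteq> 0" for h :: "'a \<Rightarrow>\<^sub>0 'b"
  proof -
    have "keys h \<noteq> {}"
      using that by (metis ex_in_conv in_keys_iff lookup_zero poly_mapping_eqI)
    then obtain a where "a \<in> keys h" "w a = Min (w ` keys h)"
      by (metis (mono_tags, lifting) Min_in finite_imageI finite_keys image_iff image_is_empty)
    then have "a \<in> keys (keep {a. w a = Min (w ` keys h)} h)"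
      by (simp add: keys_keep)
    then show ?thesis
      by (intro exI[of _ "Min (w ` keys h)"]) auto
  qed
  obtain \<alpha> where \<alpha>: "\<And>a. a \<in> keys f \<Longrightarrow> \<alpha> \<le> w a" "keep {a. w a = \<alpha>} f \<noteq> 0"
    using initial[OF \<open>f \<noteq> 0\<close>] by blast
  obtain \<beta> where \<beta>: "\<And>b. b \<in> keys g \<Longrightarrow> \<beta> \<le> w b" "keep {a. w a = \<beta>} g \<noteq> 0"
    using initial[OF \<open>g \<noteq> 0\<close>] by blast
  let ?f0 = "keep {a. w a = \<alpha>} f" and ?f1 = "keep (- {a. w a = \<alpha>}) f"
  let ?g0 = "keep {a. w a = \<beta>} g" and ?g1 = "keep (- {a. w a = \<beta>}) g"
  \<comment> \<open>The coefficients form a domain and the exponents carry a linear order compatible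
    with addition, so the monoid algebra has no zero divisors.\<close>
  have "?f0 * ?g0 \<noteq> 0"
    using \<alpha>(2) \<beta>(2) by simp
  then obtain c where c: "c \<in> keys (?f0 * ?g0)"
    by (metis ex_in_conv in_keys_iff lookup_zero poly_mapping_eqI)
  then obtain a b where ab: "c = a + b" "a \<in> keys ?f0" "b \<in> keys ?g0"
    using Poly_Mapping.keys_mult[of ?f0 ?g0] by blast
  have fg: "f * g = ?f0 * ?g0 + (?f0 * ?g1 + ?f1 * g)"
    by (metis (no_types) add.assoc distrib_left distrib_right keep_Compl)
  have "?f0 * ?g1 + ?f1 * g \<in> supported {a. \<alpha> + \<beta> < w a}"
  proof (rule add_in_supported)
    have "?f0 \<in> supported {a. w a = \<alpha>}" "?g1 \<in> supported {b. \<beta> < w b}"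
      "?f1 \<in> supported {a. \<alpha> < w a}" "g \<in> supported {b. \<beta> \<le> w b}"
      using \<alpha>(1) \<beta>(1) by (force simp: supported_def keys_keep)+
    then show "?f0 * ?g1 \<in> supported {a. \<alpha> + \<beta> < w a}" "?f1 * g \<in> supported {a. \<alpha> + \<beta> < w a}"
      by (auto elim!: mult_in_supported simp: w)
  qed
  moreover have "w c = \<alpha> + \<beta>"
    using ab by (simp add: w keys_keep)
  ultimately have "c \<notin> keys (?f0 * ?g1 + ?f1 * g)"
    unfolding supported_def by auto
  with c have "c \<in> keys (f * g)"
    unfolding fg by (simp add: lookup_add in_keys_iff)
  with ab \<alpha>(1) \<beta>(1) that[of a b] show ?thesis
    by (simp add: keys_keep)
qed

section \<open>Subrings of type-based rings\<close>

lemma cring_subring_of_type_algebra: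
  fixes S :: "'a::comm_ring_1 set"
  assumes "1 \<in> S" "\<And>x y. x \<in> S \<Longrightarrow> y \<in> S \<Longrightarrow> x + y \<in> S"
    "\<And>x y. x \<in> S \<Longrightarrow> y \<in> S \<Longrightarrow> x * y \<in> S" "\<And>x. x \<in> S \<Longrightarrow> - x \<in> S"
  shows "cring (ring_of_type_algebra\<lparr>carrier := S\<rparr>)"
proof -
  have "0 \<in> S"
    using assms(2)[OF assms(1) assms(4)[OF assms(1)]] by simp
  then show ?thesis
    using assms
    by (intro cringI abelian_groupI comm_monoidI)
      (auto simp: ring_of_type_algebra_def algebra_simps intro!: bexI[of _ "- _"])
qed

lemma ringD_of_type_algebra:
  fixes S :: "'a::comm_ring_1 set"
  assumes "ring (ring_of_type_algebra\<lparr>carrier := S\<rparr>)" (is "ring ?R")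
  shows "1 \<in> S" "\<And>x y. x \<in> S \<Longrightarrow> y \<in> S \<Longrightarrow> x + y \<in> S"
    "\<And>x y. x \<in> S \<Longrightarrow> y \<in> S \<Longrightarrow> x * y \<in> S" "\<And>x. x \<in> S \<Longrightarrow> - x \<in> S"
proof -
  interpret ring ?R by fact
  show "1 \<in> S"
    using one_closed by (simp add: ring_of_type_algebra_def)
  show "x + y \<in> S" "x * y \<in> S" if "x \<in> S" "y \<in> S" for x y
    using a_closed[of x y] m_closed[of x y] that by (simp_all add: ring_of_type_algebra_def)
  show "- x \<in> S" if x: "x \<in> S" for x
  proof -
    obtain y where "y \<in> S" "x + y = 0"
      using add.r_inv_ex[of x] x by (auto simp: ring_of_type_algebra_def)
    then show ?thesis
      by (simp add: add_eq_0_iff)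
  qed
qed

lemma ideal_of_type_algebra:
  fixes S :: "'a::comm_ring_1 set"
  assumes "cring (ring_of_type_algebra\<lparr>carrier := S\<rparr>)" "J \<subseteq> S" "0 \<in> J"
    "\<And>x y. x \<in> J \<Longrightarrow> y \<in> J \<Longrightarrow> x + y \<in> J" "\<And>x. x \<in> J \<Longrightarrow> - x \<in> J"
    "\<And>x y. x \<in> S \<Longrightarrow> y \<in> J \<Longrightarrow> x * y \<in> J"
  shows "ideal J (ring_of_type_algebra\<lparr>carrier := S\<rparr>)" (is "ideal J ?R")
proof (rule idealI)
  interpret cring ?R by fact
  show "ring ?R" ..
  have inv: "\<ominus>\<^bsub>?R\<^esub> x = - x" if "x \<in> J" for x
    using that assms(2,5)
    by (intro add.inv_equality[of "- x" x, simplified a_inv_def[symmetric]])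
      (auto simp: ring_of_type_algebra_def)
  show "subgroup J (add_monoid ?R)"
    by (rule add.subgroupI)
       (use assms inv in \<open>auto simp: ring_of_type_algebra_def a_inv_def\<close>)
  show "x \<otimes>\<^bsub>?R\<^esub> a \<in> J" "a \<otimes>\<^bsub>?R\<^esub> x \<in> J" if "a \<in> J" "x \<in> carrier ?R" for a x
    using assms(6)[of x a] that by (simp_all add: ring_of_type_algebra_def mult.commute)
qed

lemma idealD_of_type_algebra:
  fixes S :: "'a::comm_ring_1 set"
  assumes "ideal J (ring_of_type_algebra\<lparr>carrier := S\<rparr>)" (is "ideal J ?R")
  shows "J \<subseteq> S" "0 \<in> J" "\<And>x y. x \<in> J \<Longrightarrow> y \<in> J \<Longrightarrow> x + y \<in> J"
    "\<And>x y. x \<in> S \<Longrightarrow> y \<in> J \<Longrightarrow> x * y \<in> J"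
proof -
  interpret ideal J ?R by fact
  show "J \<subseteq> S" using a_subset by simp
  show "0 \<in> J" using additive_subgroup.zero_closed[OF is_additive_subgroup]
    by (simp add: ring_of_type_algebra_def)
  show "x + y \<in> J" if "x \<in> J" "y \<in> J" for x y
    using additive_subgroup.a_closed[OF is_additive_subgroup that]
    by (simp add: ring_of_type_algebra_def)
  show "x * y \<in> J" if "x \<in> S" "y \<in> J" for x y
    using I_l_closed[of y x] that by (simp add: ring_of_type_algebra_def)
qed

lemma ideal_sum_of_type_algebra:
  fixes S :: "'a::comm_ring_1 set"
  assumes "ideal J (ring_of_type_algebra\<lparr>carrier := S\<rparr>)" "\<And>i. i \<in> N \<Longrightarrow> F i \<in> J"
  shows "sum F N \<in> J"
  using assms(2) idealD_of_type_algebra[OF assms(1)]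
  by (induction N rule: infinite_finite_induct) auto

section \<open>Retractions of monoid algebras\<close>

definition monoid_algebra :: "'a::comm_monoid_add set \<Rightarrow> ('a \<Rightarrow>\<^sub>0 'b::comm_ring_1) ring" where
  "monoid_algebra A = ring_of_type_algebra\<lparr>carrier := supported A\<rparr>"

lemma monoid_algebra_simps [simp]:
  "carrier (monoid_algebra A) = supported A"
  "f \<otimes>\<^bsub>monoid_algebra A\<^esub> g = f * g"
  "f \<oplus>\<^bsub>monoid_algebra A\<^esub> g = f + g"
  "\<one>\<^bsub>monoid_algebra A\<^esub> = 1"
  "\<zero>\<^bsub>monoid_algebra A\<^esub> = 0"
  by (simp_all add: monoid_algebra_def ring_of_type_algebra_def)

definition submonoid_of_type :: "'a::comm_monoid_add set \<Rightarrow> bool" where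
  "submonoid_of_type A \<longleftrightarrow> 0 \<in> A \<and> (\<forall>a\<in>A. \<forall>b\<in>A. a + b \<in> A)"

definition monoid_ideal :: "'a::comm_monoid_add set \<Rightarrow> 'a set \<Rightarrow> bool" where
  "monoid_ideal J A \<longleftrightarrow> J \<subseteq> A \<and> (\<forall>a\<in>A. \<forall>b\<in>J. a + b \<in> J)"

lemma cring_monoid_algebra:
  assumes "submonoid_of_type A"
  shows "cring (monoid_algebra A :: ('a::comm_monoid_add \<Rightarrow>\<^sub>0 'b::comm_ring_1) ring)"
  unfolding monoid_algebra_def
  using assms
  by (intro cring_subring_of_type_algebra)
    (auto simp: submonoid_of_type_def
      intro: one_in_supported add_in_supported uminus_in_supported mult_in_supported)

lemma ideal_monoid_algebra:
  assumes "submonoid_of_type A" "monoid_ideal J A"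
  shows "ideal (supported J) (monoid_algebra A :: ('a::comm_monoid_add \<Rightarrow>\<^sub>0 'b::comm_ring_1) ring)"
proof -
  have "supported J \<subseteq> (supported A :: ('a \<Rightarrow>\<^sub>0 'b) set)"
    using assms(2) by (intro supported_mono) (simp add: monoid_ideal_def)
  moreover have "f * g \<in> supported J"
    if "f \<in> supported A" "g \<in> supported J" for f g :: "'a \<Rightarrow>\<^sub>0 'b"
    using that assms(2) by (auto elim!: mult_in_supported simp: monoid_ideal_def)
  ultimately show ?thesis
    using cring_monoid_algebra[OF assms(1), where ?'b = 'b]
    unfolding monoid_algebra_def
    by (intro ideal_of_type_algebra) (auto intro: add_in_supported uminus_in_supported)
qed

text \<open>By the last hypothesis, adding an element of \<open>A\<close> to one of
  \<open>B - A\<close> never leads into \<open>A\<close>. The terms over \<open>B - A\<close>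
  therefore span a complementary submodule, and \<open>keep A\<close> is the projection along
  it.\<close>

lemma monoid_algebra_retract:
  assumes "submonoid_of_type A" "submonoid_of_type B" "A \<subseteq> B"
    and "\<And>a b. a \<in> A \<Longrightarrow> b \<in> B \<Longrightarrow> a + b \<in> A \<Longrightarrow> b \<in> A"
  shows "ring_map_splits (monoid_algebra A :: ('a::comm_monoid_add \<Rightarrow>\<^sub>0 'b::comm_ring_1) ring)
    (monoid_algebra B) (\<lambda>f. f)"
  unfolding ring_map_splits_def
proof (intro conjI exI[of _ "keep A"] ballI)
  show "ring_hom_cring (monoid_algebra A :: ('a \<Rightarrow>\<^sub>0 'b) ring) (monoid_algebra B) (\<lambda>f. f)"
    using supported_mono[OF assms(3), where ?'b = 'b] assms(1,2)
    by (intro ring_hom_cring.intro ring_hom_cring_axioms.intro cring_monoid_algebra)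
      (auto simp: ring_hom_def)
  show "keep A (f \<otimes>\<^bsub>monoid_algebra B\<^esub> g) = f \<otimes>\<^bsub>monoid_algebra A\<^esub> keep A g"
    if "f \<in> carrier (monoid_algebra A)" "g \<in> carrier (monoid_algebra B)" for f g :: "'a \<Rightarrow>\<^sub>0 'b"
    using that assms by (auto intro!: keep_mult simp: submonoid_of_type_def)
qed (auto simp: keep_in_supported keep_add keep_supported)

lemma coset_monoid_algebra:
  "supported J +>\<^bsub>monoid_algebra A\<^esub> f = {g. g - f \<in> supported J}"
  for f :: "'a::comm_monoid_add \<Rightarrow>\<^sub>0 'b::comm_ring_1"
  by (auto simp: a_r_coset_def' intro: bexI[of _ "_ - f"])

lemma coset_monoid_algebra_eq_iff:
  "{h. h - f \<in> supported J} = {h. h - g \<in> supported J} \<longleftrightarrow> f - g \<in> supported J"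
  for f g :: "'a \<Rightarrow>\<^sub>0 'b::ab_group_add"
proof
  assume "{h. h - f \<in> supported J} = {h. h - g \<in> supported J}"
  moreover have "f \<in> {h. h - f \<in> supported J}"
    by simp
  ultimately show "f - g \<in> supported J"
    by blast
next
  assume fg: "f - g \<in> supported J"
  have "h - f \<in> supported J \<longleftrightarrow> h - g \<in> supported J" for h
    using add_in_supported[of "h - f" J "f - g"] diff_in_supported[of "h - g" J "f - g"] fg
    by auto
  then show "{h. h - f \<in> supported J} = {h. h - g \<in> supported J}"
    by blast
qed

text \<open>Cosets are written as explicit sets of elements, so that computations in the quotient
  become computations with representatives.\<close>

lemma Quot_monoid_algebra:
  fixes A :: "'a::comm_monoid_add set"
  assumes "submonoid_of_type A" "monoid_ideal J A"
  defines "Q \<equiv> (monoid_algebra A :: ('a \<Rightarrow>\<^sub>0 'b::comm_ring_1) ring) Quot supported J"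
  shows "carrier Q = (\<lambda>f. {h. h - f \<in> supported J}) ` supported A"
    and "f \<in> supported A \<Longrightarrow> g \<in> supported A \<Longrightarrow>
      {h. h - f \<in> supported J} \<oplus>\<^bsub>Q\<^esub> {h. h - g \<in> supported J} = {h. h - (f + g) \<in> supported J}"
    and "f \<in> supported A \<Longrightarrow> g \<in> supported A \<Longrightarrow>
      {h. h - f \<in> supported J} \<otimes>\<^bsub>Q\<^esub> {h. h - g \<in> supported J} = {h. h - f * g \<in> supported J}"
    and "\<one>\<^bsub>Q\<^esub> = {h. h - 1 \<in> supported J}"
    and "cring Q"
proof -
  interpret ideal "supported J" "monoid_algebra A :: ('a \<Rightarrow>\<^sub>0 'b) ring"
    by (rule ideal_monoid_algebra) fact+
  show "carrier Q = (\<lambda>f. {h. h - f \<in> supported J}) ` supported A"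
    by (auto simp: Q_def FactRing_def A_RCOSETS_def' coset_monoid_algebra)
  show "{h. h - f \<in> supported J} \<oplus>\<^bsub>Q\<^esub> {h. h - g \<in> supported J} = {h. h - (f + g) \<in> supported J}"
    if "f \<in> supported A" "g \<in> supported A"
    using a_rcos_sum[of f g] that by (simp add: Q_def FactRing_def coset_monoid_algebra)
  show "{h. h - f \<in> supported J} \<otimes>\<^bsub>Q\<^esub> {h. h - g \<in> supported J} = {h. h - f * g \<in> supported J}"
    if "f \<in> supported A" "g \<in> supported A"
    using rcoset_mult_add[of f g] that by (simp add: Q_def FactRing_def coset_monoid_algebra)
  show "\<one>\<^bsub>Q\<^esub> = {h. h - 1 \<in> supported J}"
    by (simp add: Q_def FactRing_def coset_monoid_algebra)
  show "cring Q"
    unfolding Q_def using cring_monoid_algebra[OF assms(1)] by (rule quotient_is_cring)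
qed

text \<open>Both maps descend to the quotients: the inclusion because
  \<open>J \<subseteq> K\<close>, the truncation because an element over \<open>K\<close> is
  truncated to one over \<open>K \<inter> A\<close>, hence over \<open>J\<close>.\<close>

lemma monoid_algebra_Quot_retract:
  fixes A :: "'a::comm_monoid_add set"
  assumes "submonoid_of_type A" "submonoid_of_type B" "A \<subseteq> B"
    and "monoid_ideal J A" "monoid_ideal K B" "J \<subseteq> K" "K \<inter> A \<subseteq> J"
    and "\<And>a b. a \<in> A \<Longrightarrow> b \<in> B \<Longrightarrow> a + b \<in> A \<Longrightarrow> b \<in> A"
  shows "ring_map_splits ((monoid_algebra A :: ('a \<Rightarrow>\<^sub>0 'b::comm_ring_1) ring) Quot supported J)
    (monoid_algebra B Quot supported K)
    (\<lambda>C. \<Union>f\<in>C. supported K +>\<^bsub>monoid_algebra B\<^esub> f)"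
    (is "ring_map_splits ?S ?T ?\<phi>")
proof -
  define c where "c f = {h. h - f \<in> supported J}" for f :: "'a \<Rightarrow>\<^sub>0 'b"
  define c' where "c' f = {h. h - f \<in> supported K}" for f :: "'a \<Rightarrow>\<^sub>0 'b"
  \<comment> \<open>The union over the coset avoids a choice of representative; all members of a
    coset of \<open>supported K\<close> contribute the same coset of
    \<open>supported J\<close>.\<close>
  define \<psi> where "\<psi> = (\<lambda>C. \<Union>f\<in>C. c (keep A f))"
  note S = Quot_monoid_algebra[OF assms(1,4), where ?'b = 'b, folded c_def]
  note T = Quot_monoid_algebra[OF assms(2,5), where ?'b = 'b, folded c'_def]
  have sub: "supported A \<subseteq> (supported B :: ('a \<Rightarrow>\<^sub>0 'b) set)"
    using assms(3) by (rule supported_mono)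
  have closed: "f + g \<in> supported M" "f * g \<in> supported M"
    if "f \<in> supported M" "g \<in> supported M" "submonoid_of_type M" for f g :: "'a \<Rightarrow>\<^sub>0 'b" and M
    using that add_in_supported mult_in_supported[of f M g M M]
    by (auto simp: submonoid_of_type_def)
  have \<phi>: "?\<phi> (c f) = c' f" for f
  proof -
    have "c' g = c' f" if "g \<in> c f" for g
      using that supported_mono[OF assms(6)]
      by (auto simp: c_def c'_def coset_monoid_algebra_eq_iff)
    moreover have "f \<in> c f"
      by (simp add: c_def)
    ultimately show ?thesis
      unfolding coset_monoid_algebra c'_def[symmetric] by (intro SUP_eq_const) blast+
  qed
  have \<psi>: "\<psi> (c' f) = c (keep A f)" for f
  proof -
    have "c (keep A g) = c (keep A f)" if "g \<in> c' f" for g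
    proof -
      have "keep A (g - f) \<in> supported J"
        using that assms(7) by (auto simp: c'_def supported_def keys_keep)
      then show ?thesis
        by (simp add: c_def coset_monoid_algebra_eq_iff keep_diff)
    qed
    moreover have "f \<in> c' f"
      by (simp add: c'_def)
    ultimately show ?thesis
      unfolding \<psi>_def by (intro SUP_eq_const) blast+
  qed
  show ?thesis
    unfolding ring_map_splits_def
  proof (intro conjI exI[of _ \<psi>] ballI)
    show "ring_hom_cring ?S ?T ?\<phi>"
    proof (intro ring_hom_cring.intro ring_hom_cring_axioms.intro S(5) T(5) ring_hom_memI)
      show "?\<phi> x \<in> carrier ?T" if "x \<in> carrier ?S" for x
        using that sub by (auto simp: S(1) T(1) \<phi> simp del: UN_iff)
      show "?\<phi> (x \<otimes>\<^bsub>?S\<^esub> y) = ?\<phi> x \<otimes>\<^bsub>?T\<^esub> ?\<phi> y" "?\<phi> (x \<oplus>\<^bsub>?S\<^esub> y) = ?\<phi> x \<oplus>\<^bsub>?T\<^esub> ?\<phi> y"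
        if xy: "x \<in> carrier ?S" "y \<in> carrier ?S" for x y
      proof -
        obtain f g where fg: "x = c f" "y = c g" "f \<in> supported A" "g \<in> supported A"
          using xy by (auto simp: S(1))
        then have fgB: "f \<in> supported B" "g \<in> supported B"
          using sub by auto
        show "?\<phi> (x \<otimes>\<^bsub>?S\<^esub> y) = ?\<phi> x \<otimes>\<^bsub>?T\<^esub> ?\<phi> y"
          "?\<phi> (x \<oplus>\<^bsub>?S\<^esub> y) = ?\<phi> x \<oplus>\<^bsub>?T\<^esub> ?\<phi> y"
          by (simp_all only: fg(1,2) S(2,3)[OF fg(3,4)] T(2,3)[OF fgB] \<phi>)
      qed
      show "?\<phi> \<one>\<^bsub>?S\<^esub> = \<one>\<^bsub>?T\<^esub>"
        by (simp only: S(4) T(4) \<phi>)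
    qed
    show "\<psi> \<in> carrier ?T \<rightarrow> carrier ?S"
      by (auto simp: S(1) T(1) \<psi> intro!: imageI keep_in_supported)
    show "\<psi> (u \<oplus>\<^bsub>?T\<^esub> v) = \<psi> u \<oplus>\<^bsub>?S\<^esub> \<psi> v"
      if uv: "u \<in> carrier ?T" "v \<in> carrier ?T" for u v
    proof -
      obtain f g where fg: "u = c' f" "v = c' g" "f \<in> supported B" "g \<in> supported B"
        using uv by (auto simp: T(1))
      then show ?thesis
        by (simp only: fg T(2) S(2) \<psi> keep_add keep_in_supported)
    qed
    show "\<psi> (?\<phi> s \<otimes>\<^bsub>?T\<^esub> u) = s \<otimes>\<^bsub>?S\<^esub> \<psi> u"
      if su: "s \<in> carrier ?S" "u \<in> carrier ?T" for s u
    proof -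
      obtain f g where fg: "s = c f" "u = c' g" "f \<in> supported A" "g \<in> supported B"
        using su by (auto simp: S(1) T(1))
      have "keep A (f * g) = f * keep A g"
        using assms(1)
        by (intro keep_mult[OF fg(3,4)]) (simp add: submonoid_of_type_def, rule assms(8))
      moreover have "f \<in> supported B"
        using fg(3) sub by auto
      ultimately show ?thesis
        using fg(3,4) by (simp only: fg(1,2) T(3) S(3) \<psi> \<phi> keep_in_supported)
    qed
    show "\<psi> (?\<phi> s) = s" if s: "s \<in> carrier ?S" for s
    proof -
      obtain f where "s = c f" "f \<in> supported A"
        using s by (auto simp: S(1))
      then show ?thesis
        by (simp only: \<phi> \<psi> keep_supported)
    qed
  qed
qed

section \<open>Contraction from localizations\<close>

text \<open>The complement of a prime is multiplicatively closed, contains 1 and omits 0, so the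
  fractions with such denominators are closed under the ring operations.\<close>

lemma cring_localization_at:
  fixes S :: "'a::idom set"
  assumes "primeideal p (ring_of_type_algebra\<lparr>carrier := S\<rparr>)"
  shows "cring (localization_at S p)"
proof -
  interpret primeideal p "ring_of_type_algebra\<lparr>carrier := S\<rparr>" by fact
  note p = idealD_of_type_algebra[OF is_ideal]
  note S = ringD_of_type_algebra[OF ring_axioms]
  have one: "1 \<notin> p"
    using I_notcarr p(1) p(4)[of _ 1] by force
  have prime: "s * t \<in> S - p" if "s \<in> S - p" "t \<in> S - p" for s t
    using I_prime[of s t] that S(3) by (auto simp: ring_of_type_algebra_def)
  have nz: "s \<noteq> 0" if "s \<in> S - p" for s
    using that p(2) by auto
  show ?thesis
    unfolding localization_at_def
  proof (rule cring_subring_of_type_algebra)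
    show "1 \<in> {Fract a s |a s. a \<in> S \<and> s \<in> S - p}"
      using one S(1) by (auto simp: One_fract_def)
    show "x + y \<in> {Fract a s |a s. a \<in> S \<and> s \<in> S - p}"
      if xy: "x \<in> {Fract a s |a s. a \<in> S \<and> s \<in> S - p}"
        "y \<in> {Fract a s |a s. a \<in> S \<and> s \<in> S - p}" for x y
    proof -
      obtain a s b t where "x = Fract a s" "y = Fract b t" "a \<in> S" "b \<in> S" "s \<in> S - p" "t \<in> S - p"
        using xy by blast
      then show ?thesis
        using nz prime[of s t] S(2,3)
        by (intro CollectI exI[of _ "a * t + b * s"] exI[of _ "s * t"]) auto
    qed
    show "x * y \<in> {Fract a s |a s. a \<in> S \<and> s \<in> S - p}"
      if xy: "x \<in> {Fract a s |a s. a \<in> S \<and> s \<in> S - p}"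
        "y \<in> {Fract a s |a s. a \<in> S \<and> s \<in> S - p}" for x y
    proof -
      obtain a s b t where "x = Fract a s" "y = Fract b t" "a \<in> S" "b \<in> S" "s \<in> S - p" "t \<in> S - p"
        using xy by blast
      then show ?thesis
        using prime[of s t] S(3)
        by (intro CollectI exI[of _ "a * b"] exI[of _ "s * t"]) auto
    qed
    show "- x \<in> {Fract a s |a s. a \<in> S \<and> s \<in> S - p}"
      if "x \<in> {Fract a s |a s. a \<in> S \<and> s \<in> S - p}" for x
      using that S(4) by (force simp del: minus_diff_eq)
  qed
qed

text \<open>The fractions with numerator in \<open>Q\<close> and denominator outside
  \<open>p\<close> form an ideal of the localization that contains the image of \<open>J\<close>. If
  \<open>f\<close> equals such a fraction \<open>a / s\<close>, then \<open>f * s = a\<close> lies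
  in \<open>Q\<close>, and \<open>s\<close> can be cancelled because \<open>Q\<close> behaves like a
  \<open>p\<close>-primary ideal.\<close>

lemma local_contraction_subset:
  fixes S :: "'a::idom set"
  assumes p: "primeideal p (ring_of_type_algebra\<lparr>carrier := S\<rparr>)"
    and Q: "ideal Q (ring_of_type_algebra\<lparr>carrier := S\<rparr>)" and "J \<subseteq> Q"
    and primary: "\<And>f s. f \<in> S \<Longrightarrow> s \<in> S - p \<Longrightarrow> f * s \<in> Q \<Longrightarrow> f \<in> Q"
  shows "local_contraction S p J \<subseteq> Q"
proof
  interpret primeideal p "ring_of_type_algebra\<lparr>carrier := S\<rparr>" by fact
  note p = idealD_of_type_algebra[OF is_ideal] and Q = idealD_of_type_algebra[OF Q]
    and S = ringD_of_type_algebra[OF ring_axioms]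
  have one: "1 \<in> S - p"
    using I_notcarr p(1) p(4)[of _ 1] one_closed by (force simp: ring_of_type_algebra_def)
  have prime: "s * t \<in> S - p" if "s \<in> S - p" "t \<in> S - p" for s t
    using I_prime[of s t] m_closed[of s t] that by (auto simp: ring_of_type_algebra_def)
  have nz: "s \<noteq> 0" if "s \<in> S - p" for s
    using that p(2) by auto
  have Q_uminus: "- x \<in> Q" if "x \<in> Q" for x
    using Q(4)[of "- 1" x] that S(1,4) by simp
  let ?K = "{Fract a s |a s. a \<in> Q \<and> s \<in> S - p}"
  have "ideal ?K (localization_at S p)"
    unfolding localization_at_def
  proof (rule ideal_of_type_algebra)
    show "cring (ring_of_type_algebra\<lparr>carrier := {Fract a s |a s. a \<in> S \<and> s \<in> S - p}\<rparr>)"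
      using cring_localization_at[OF assms(1)] by (simp add: localization_at_def)
    show "?K \<subseteq> {Fract a s |a s. a \<in> S \<and> s \<in> S - p}"
      using Q(1) by blast
    show "0 \<in> ?K"
      using Q(2) one by (auto simp: Zero_fract_def)
    show "x + y \<in> ?K" if "x \<in> ?K" "y \<in> ?K" for x y
    proof -
      obtain a s b t where "x = Fract a s" "y = Fract b t" "a \<in> Q" "b \<in> Q" "s \<in> S - p" "t \<in> S - p"
        using \<open>x \<in> ?K\<close> \<open>y \<in> ?K\<close> by blast
      then show ?thesis
        using nz prime[of s t] Q(3) Q(4)[of t a] Q(4)[of s b]
        by (intro CollectI exI[of _ "a * t + b * s"] exI[of _ "s * t"]) (auto simp: mult.commute)
    qed
    show "- x \<in> ?K" if "x \<in> ?K" for x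
      using that Q_uminus by fastforce
    show "x * y \<in> ?K" if "x \<in> {Fract a s |a s. a \<in> S \<and> s \<in> S - p}" "y \<in> ?K" for x y
      using that prime Q(4) by fastforce
  qed
  moreover have "(\<lambda>a. Fract a 1) ` J \<subseteq> ?K"
    using \<open>J \<subseteq> Q\<close> one by blast
  ultimately have K: "genideal (localization_at S p) ((\<lambda>a. Fract a 1) ` J) \<subseteq> ?K"
    unfolding genideal_def by blast
  fix f
  assume f: "f \<in> local_contraction S p J"
  then obtain a s where as: "Fract f 1 = Fract a s" "a \<in> Q" "s \<in> S - p"
    using K by (auto simp: local_contraction_def)
  then have "f * s = a"
    using nz[of s] by (simp add: eq_fract)
  then show "f \<in> Q"
    using primary[of f s] f as by (simp add: local_contraction_def)
qed

text \<open>In the localization \<open>f\<close> is the product of \<open>1 / s\<close> with the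
  image of \<open>f * s\<close>.\<close>

lemma in_local_contraction:
  fixes S :: "'a::idom set"
  assumes "f \<in> S" "s \<in> S - p" "f * s \<in> J" "0 \<in> p" "1 \<in> S"
  shows "f \<in> local_contraction S p J"
proof -
  have "Fract f 1 \<in> K" if "ideal K (localization_at S p)" "(\<lambda>a. Fract a 1) ` J \<subseteq> K" for K
  proof -
    have "Fract 1 s \<in> {Fract a s |a s. a \<in> S \<and> s \<in> S - p}" "Fract (f * s) 1 \<in> K"
      using assms that(2) by auto
    then have "Fract 1 s * Fract (f * s) 1 \<in> K"
      using that(1) unfolding localization_at_def by (intro idealD_of_type_algebra(4))
    moreover have "s \<noteq> 0"
      using assms(2,4) by auto
    then have "Fract 1 s * Fract (f * s) 1 = Fract f 1"
      by (simp add: eq_fract)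
    ultimately show ?thesis
      by simp
  qed
  then show ?thesis
    using assms(1) by (auto simp: local_contraction_def genideal_def)
qed

section \<open>Ideals of bounded weight\<close>

definition exponents :: "nat \<Rightarrow> nat set \<Rightarrow> (nat \<Rightarrow>\<^sub>0 rat) set" where
  "exponents m V = {a. keys a \<subseteq> V \<and> (\<forall>i. of_nat m * lookup a i \<in> \<nat>)}"

text \<open>For \<open>P \<subseteq> {1..d}\<close> this is the degree of the monomial in the
  variables indexed by \<open>P\<close>, that is, its order along the prime that they
  generate.\<close>

definition weight :: "nat set \<Rightarrow> (nat \<Rightarrow>\<^sub>0 rat) \<Rightarrow> rat" where
  "weight P a = (\<Sum>i\<in>P. lookup a i)"

lemma root_poly_ring_eq: "root_poly_ring m V = monoid_algebra (exponents m V)"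
  by (auto simp: root_poly_ring_def monoid_algebra_def supported_def exponents_def subset_iff
      intro!: arg_cong[of _ _ "\<lambda>S. _\<lparr>carrier := S\<rparr>"])

lemma exponents_add: "a \<in> exponents m V \<Longrightarrow> b \<in> exponents m V \<Longrightarrow> a + b \<in> exponents m V"
  using Poly_Mapping.keys_add[of a b] by (auto simp: exponents_def lookup_add distrib_left)

lemma submonoid_exponents: "submonoid_of_type (exponents m V)"
  by (auto simp: submonoid_of_type_def exponents_add) (simp add: exponents_def)

lemma exponents_nonneg:
  assumes "a \<in> exponents m V" "m > 0"
  shows "0 \<le> lookup a i"
proof -
  have "0 \<le> of_nat m * lookup a i"
    using assms by (simp add: exponents_def Nats_altdef2)
  then show ?thesis
    using assms(2) by (simp add: zero_le_mult_iff)
qed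

lemma weight_add: "weight P (a + b) = weight P a + weight P b"
  by (simp add: weight_def lookup_add sum.distrib)

lemma weight_nonneg: "a \<in> exponents m V \<Longrightarrow> m > 0 \<Longrightarrow> 0 \<le> weight P a"
  by (simp add: weight_def sum_nonneg exponents_nonneg)

lemma Nats_sum: "(\<And>i. i \<in> P \<Longrightarrow> f i \<in> \<nat>) \<Longrightarrow> sum f P \<in> (\<nat> :: 'a::semiring_1 set)"
  by (induction P rule: infinite_finite_induct) auto

lemma weight_Nats: "a \<in> exponents 1 V \<Longrightarrow> weight P a \<in> \<nat>"
  by (simp add: weight_def Nats_sum exponents_def)

lemma weight_single: "finite P \<Longrightarrow> weight P (single i c) = (if i \<in> P then c else 0)"
  by (simp add: weight_def lookup_single when_def)

text \<open>For \<open>P \<subseteq> {1..d}\<close> this is the \<open>n\<close>-th power of the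
  prime generated by the variables indexed by \<open>P\<close>, given by its monomials instead of as
  a product of ideals.\<close>

definition weight_ideal :: "nat \<Rightarrow> nat set \<Rightarrow> nat \<Rightarrow> 'k::field frac_poly set" where
  "weight_ideal d P n = supported {a \<in> exponents 1 {1..d}. of_nat n \<le> weight P a}"

lemma weight_ideal_subset: "weight_ideal d P n \<subseteq> supported (exponents 1 {1..d})"
  unfolding weight_ideal_def by (rule supported_mono) auto

lemma ideal_weight_ideal: "ideal (weight_ideal d P n) (R_poly d :: 'k::field frac_poly ring)"
  unfolding root_poly_ring_eq weight_ideal_def
proof (rule ideal_monoid_algebra[OF submonoid_exponents])
  have "of_nat n \<le> weight P a + weight P b"
    if "a \<in> exponents 1 {1..d}" "of_nat n \<le> weight P b" for a b
    using weight_nonneg[OF that(1), of P] that(2) by simp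
  then show "monoid_ideal {a \<in> exponents 1 {1..d}. of_nat n \<le> weight P a} (exponents 1 {1..d})"
    by (auto simp: monoid_ideal_def exponents_add weight_add)
qed

text \<open>The least weight is additive on products, and that of \<open>g\<close> is 0 because
  \<open>g\<close> lies outside the prime. So the least weight of \<open>f\<close> is that of
  \<open>f * g\<close>. This says that powers of the prime are primary.\<close>

lemma weight_ideal_mult_cancel:
  fixes f g :: "'k::field frac_poly"
  assumes "f \<in> supported (exponents 1 {1..d})" "g \<in> supported (exponents 1 {1..d})"
    and "f * g \<in> weight_ideal d P n" "g \<notin> weight_ideal d P 1"
  shows "f \<in> weight_ideal d P n"
proof (cases "f = 0")
  case False
  obtain b0 where b0: "b0 \<in> keys g" "weight P b0 < 1"
    using assms(2,4) by (force simp: weight_ideal_def supported_def)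
  \<comment> \<open>Weights of integral exponents are natural numbers, so a weight below 1
    vanishes.\<close>
  then have "weight P b0 = 0"
    using assms(2) weight_Nats[of b0 "{1..d}" P] by (force simp: supported_def elim!: Nats_cases)
  have "g \<noteq> 0"
    using b0 by auto
  obtain a b where "a \<in> keys f" "b \<in> keys g" "a + b \<in> keys (f * g)"
    and a: "\<forall>a'\<in>keys f. weight P a \<le> weight P a'"
    and b: "\<forall>b'\<in>keys g. weight P b \<le> weight P b'"
    by (rule minimal_degree_mult[of "weight P", OF weight_add False \<open>g \<noteq> 0\<close>])
  have "of_nat n \<le> weight P a + weight P b"
    using \<open>a + b \<in> _\<close> assms(3) by (auto simp: weight_ideal_def supported_def weight_add)
  then have "of_nat n \<le> weight P a"
    using b b0(1) \<open>weight P b0 = 0\<close> by fastforce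
  then show ?thesis
    using a assms(1) by (force simp: weight_ideal_def supported_def)
qed (simp add: weight_ideal_def)

text \<open>The case \<open>n = 1\<close> of the cancellation is the prime property, and 1 stays
  outside because its exponent has weight 0.\<close>

lemma primeideal_weight_ideal:
  "primeideal (weight_ideal d P 1) (R_poly d :: 'k::field frac_poly ring)"
proof (rule primeidealI)
  show "cring (R_poly d :: 'k frac_poly ring)"
    unfolding root_poly_ring_eq by (rule cring_monoid_algebra[OF submonoid_exponents])
  have "1 \<in> carrier (R_poly d :: 'k frac_poly ring)" "1 \<notin> (weight_ideal d P 1 :: 'k frac_poly set)"
    using submonoid_exponents[of 1 "{1..d}"]
    by (auto simp: root_poly_ring_eq supported_def weight_ideal_def submonoid_of_type_def weight_def)
  then show "carrier (R_poly d :: 'k frac_poly ring) \<noteq> weight_ideal d P 1"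
    by auto
  show "f \<in> weight_ideal d P 1 \<or> g \<in> weight_ideal d P 1"
    if "f \<in> carrier (R_poly d)" "g \<in> carrier (R_poly d)" "f \<otimes>\<^bsub>R_poly d\<^esub> g \<in> weight_ideal d P 1"
    for f g :: "'k frac_poly"
    using that weight_ideal_mult_cancel[of f d g P 1] by (auto simp: root_poly_ring_eq)
qed (rule ideal_weight_ideal)

section \<open>Monomials in ideals and primes of the polynomial ring\<close>

declare One_nat_def [simp del]

lemma monomial_add: "monomial (a + b) = monomial a * (monomial b :: 'k::field frac_poly)"
  by (simp add: monomial_def mult_single)

lemma monomial_in_supported_iff [simp]: "(monomial a :: 'k::field frac_poly) \<in> supported S \<longleftrightarrow> a \<in> S"
  by (simp add: monomial_def supported_def)

lemma monomial_nonzero: "monomial a \<noteq> (0 :: 'k::field frac_poly)"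
  by (metis monomial_def lookup_single_eq lookup_zero zero_neq_one)

lemma single_eq_monomial: "single a c = single 0 c * (monomial a :: 'k::field frac_poly)"
  by (simp add: monomial_def mult_single)

lemma single_in_exponents: "i \<in> V \<Longrightarrow> single i 1 \<in> exponents m V"
  by (auto simp: exponents_def lookup_single when_def)

lemma zero_in_exponents: "0 \<in> exponents m V"
  by (simp add: exponents_def)

lemma sum_in_exponents: "(\<And>i. i \<in> K \<Longrightarrow> F i \<in> exponents m V) \<Longrightarrow> sum F K \<in> exponents m V"
  by (induction K rule: infinite_finite_induct) (simp_all add: zero_in_exponents exponents_add)

lemma ideal_R_polyD:
  assumes "ideal J (R_poly d :: 'k::field frac_poly ring)"
  shows "J \<subseteq> supported (exponents 1 {1..d})" "0 \<in> J" "\<And>f g. f \<in> J \<Longrightarrow> g \<in> J \<Longrightarrow> f + g \<in> J"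
    "\<And>f g. f \<in> supported (exponents 1 {1..d}) \<Longrightarrow> g \<in> J \<Longrightarrow> f * g \<in> J"
  using idealD_of_type_algebra[of J "supported (exponents 1 {1..d})"] assms
  by (auto simp: root_poly_ring_eq monoid_algebra_def)

lemma ideal_R_poly_sum:
  assumes "ideal J (R_poly d :: 'k::field frac_poly ring)" "\<And>i. i \<in> N \<Longrightarrow> F i \<in> J"
  shows "sum F N \<in> J"
  using ideal_sum_of_type_algebra[of J "supported (exponents 1 {1..d})" N F] assms
  by (simp add: root_poly_ring_eq monoid_algebra_def)

lemma exponents_diff:
  assumes "a \<in> exponents 1 V" "b \<in> exponents 1 V" "\<And>i. lookup b i \<le> lookup a i"
  shows "a - b \<in> exponents 1 V"
proof -
  have "keys (a - b) \<subseteq> keys a \<union> keys b"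
    by (auto simp: in_keys_iff lookup_minus)
  then have "keys (a - b) \<subseteq> V"
    using assms(1,2) by (auto simp: exponents_def)
  moreover have "lookup a i - lookup b i \<in> \<nat>" for i
    using assms by (auto simp: exponents_def Nats_altdef2)
  ultimately show ?thesis
    by (simp add: exponents_def lookup_minus)
qed

text \<open>A monomial of positive weight is divisible by some variable indexed by \<open>P\<close>,
  so every term of an element of the left-hand side is a multiple of an element of
  \<open>p\<close>.\<close>

lemma weight_ideal_one_subset:
  assumes p: "ideal p (R_poly d :: 'k::field frac_poly ring)"
    and "P \<subseteq> {1..d}" and P: "\<And>i. i \<in> P \<Longrightarrow> monomial (single i 1) \<in> p"
  shows "weight_ideal d P 1 \<subseteq> p"
proof
  fix f :: "'k frac_poly"
  assume f: "f \<in> weight_ideal d P 1"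
  have "single a (lookup f a) \<in> p" if "a \<in> keys f" for a
  proof -
    have a: "a \<in> exponents 1 {1..d}" "1 \<le> weight P a"
      using f that by (auto simp: weight_ideal_def supported_def)
    obtain i where i: "i \<in> P" "lookup a i > 0"
      using a(2) by (metis not_one_le_zero sum_nonpos weight_def linorder_not_le order_trans)
    have "single i 1 \<in> exponents 1 {1..d}"
      using i(1) assms(2) by (intro single_in_exponents) auto
    \<comment> \<open>The exponents are natural numbers here, so a positive one allows division by
      the variable.\<close>
    moreover have "1 \<le> lookup a i"
      using a(1) i(2) by (auto simp: exponents_def elim!: allE[of _ i] Nats_cases)
    ultimately have "a - single i 1 \<in> exponents 1 {1..d}"
      using a(1) exponents_nonneg[OF a(1)]
      by (intro exponents_diff) (auto simp: lookup_single when_def)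
    then have "single (a - single i 1) (lookup f a) * monomial (single i 1) \<in> p"
      using P[OF i(1)] by (intro ideal_R_polyD(4)[OF p]) (auto simp: single_in_supported)
    then show ?thesis
      by (simp add: monomial_def mult_single)
  qed
  then show "f \<in> p"
    using ideal_R_poly_sum[OF p, of "keys f" "\<lambda>a. single a (lookup f a)"] by (simp add: sum_single)
qed

text \<open>The sum of exponents stands for a product of distinct variables. Primality splits off
  one factor at a time, and the empty product is excluded because a prime is proper.\<close>

lemma primeideal_monomial:
  assumes p: "primeideal p (R_poly d :: 'k::field frac_poly ring)"
    and "finite K" "K \<subseteq> {1..d}" "monomial (\<Sum>i\<in>K. single i 1) \<in> p"
  shows "\<exists>i\<in>K. monomial (single i 1) \<in> p"
  using assms(2-4)
proof (induction K)
  case empty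
  interpret primeideal p "R_poly d :: 'k frac_poly ring" by fact
  have "1 \<in> p"
    using empty by (simp add: monomial_def)
  then show ?case
    using I_notcarr one_imp_carrier by (simp add: root_poly_ring_eq)
next
  case (insert j K)
  interpret primeideal p "R_poly d :: 'k frac_poly ring" by fact
  have "(\<Sum>i\<in>K. single i 1) \<in> exponents 1 {1..d}"
    using insert(4) by (intro sum_in_exponents) (auto intro: single_in_exponents)
  moreover have "single j 1 \<in> exponents 1 {1..d}"
    using insert by (auto intro: single_in_exponents)
  moreover have "monomial (single j 1) * monomial (\<Sum>i\<in>K. single i 1) \<in> p"
    using insert by (simp flip: monomial_add)
  ultimately have "monomial (single j 1) \<in> p \<or> monomial (\<Sum>i\<in>K. single i 1) \<in> p"
    using I_prime[of "monomial (single j 1)" "monomial (\<Sum>i\<in>K. single i 1)"]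
    by (simp add: root_poly_ring_eq)
  then show ?case
    using insert by auto
qed

lemma squarefree_eq_sum:
  assumes "\<forall>i. lookup e i \<in> {0, 1}"
  shows "e = (\<Sum>i\<in>keys e. single i (1 :: rat))"
proof -
  have "lookup e i = 1" if "i \<in> keys e" for i
    using assms that by (auto simp: in_keys_iff)
  then show ?thesis
    using sum_single[of e] by (metis (mono_tags, lifting) sum.cong)
qed

lemma minimal_primes_minimal:
  "p \<in> minimal_primes R I \<Longrightarrow> primeideal q R \<Longrightarrow> I \<subseteq> q \<Longrightarrow> q \<subseteq> p \<Longrightarrow> q = p"
  by (simp add: minimal_primes_def)

section \<open>Symbolic powers of square-free monomial ideals\<close>

locale squarefree_ideal =
  fixes d :: nat and E :: "(nat \<Rightarrow>\<^sub>0 rat) set" and I :: "'k::field frac_poly set"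
  assumes E_keys: "\<And>e. e \<in> E \<Longrightarrow> keys e \<subseteq> {1..d}"
    and E_01: "\<And>e i. e \<in> E \<Longrightarrow> lookup e i \<in> {0, 1}"
    and I_eq: "I = genideal (R_poly d) (monomial ` E)"
begin

lemma E_exponents: "E \<subseteq> exponents 1 {1..d}"
proof
  fix e assume "e \<in> E"
  then have "lookup e i \<in> \<nat>" for i
    using E_01[of e i] by auto
  then show "e \<in> exponents 1 {1..d}"
    using E_keys[OF \<open>e \<in> E\<close>] by (simp add: exponents_def)
qed

sublocale R: cring "R_poly d :: 'k frac_poly ring"
  unfolding root_poly_ring_eq by (rule cring_monoid_algebra[OF submonoid_exponents])

lemma generators: "monomial ` E \<subseteq> carrier (R_poly d :: 'k frac_poly ring)"
  using E_exponents by (auto simp: root_poly_ring_eq)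

lemma ideal_I: "ideal I (R_poly d)"
  unfolding I_eq by (rule R.genideal_ideal[OF generators])

lemma monomial_in_I: "e \<in> E \<Longrightarrow> monomial e \<in> I"
  using R.genideal_self[OF generators] by (auto simp: I_eq)

text \<open>The hypothesis makes \<open>P\<close> a vertex cover of the supports of the generators:
  each generator is divisible by a variable indexed by \<open>P\<close>, and it suffices to check
  generators.\<close>

lemma I_subset_weight_ideal:
  assumes "P \<subseteq> {1..d}" "\<And>e. e \<in> E \<Longrightarrow> \<exists>i\<in>P. lookup e i = 1"
  shows "I \<subseteq> weight_ideal d P 1"
  unfolding I_eq
proof (rule R.genideal_minimal[OF ideal_weight_ideal], safe)
  fix e assume e: "e \<in> E"
  then obtain i where "i \<in> P" "lookup e i = 1"
    using assms(2) by blast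
  moreover have "finite P"
    using assms(1) finite_subset by blast
  ultimately have "1 \<le> weight P e"
    using exponents_nonneg[of e 1 "{1..d}"] E_exponents e
      member_le_sum[of i P "lookup e"] by (auto simp: weight_def)
  then show "monomial e \<in> weight_ideal d P 1"
    using e E_exponents by (auto simp: weight_ideal_def)
qed

text \<open>A prime over \<open>I\<close> contains the prime generated by the variables lying in it, which itself
  contains \<open>I\<close>, since \<open>I\<close> is generated by products of distinct variables.\<close>

lemma minimal_primes_eq_weight_ideal:
  assumes "p \<in> minimal_primes (R_poly d) I"
  shows "\<exists>P \<subseteq> {1..d}. p = weight_ideal d P 1"
proof -
  have p: "primeideal p (R_poly d)" "I \<subseteq> p"
    using assms by (auto simp: minimal_primes_def)
  define P where "P = {i \<in> {1..d}. monomial (single i 1) \<in> p}"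
  have "weight_ideal d P 1 \<subseteq> p"
    using p(1) by (intro weight_ideal_one_subset) (auto simp: P_def primeideal_def)
  moreover have "I \<subseteq> weight_ideal d P 1"
  proof (rule I_subset_weight_ideal)
    fix e assume e: "e \<in> E"
    have "monomial (\<Sum>i\<in>keys e. single i 1) \<in> p"
      using monomial_in_I[OF e] p(2) squarefree_eq_sum[of e] E_01[OF e] by auto
    then obtain i where i: "i \<in> keys e" "monomial (single i 1) \<in> p"
      using primeideal_monomial[OF p(1) finite_keys E_keys[OF e]] by blast
    then have "lookup e i = 1"
      using E_01[OF e, of i] by (simp add: in_keys_iff)
    moreover have "i \<in> {1..d}"
      using i(1) E_keys[OF e] by blast
    ultimately show "\<exists>i\<in>P. lookup e i = 1"
      using i(2) unfolding P_def by blast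
  qed (auto simp: P_def)
  ultimately have "weight_ideal d P 1 = p"
    using minimal_primes_minimal[OF assms primeideal_weight_ideal] by blast
  moreover have "P \<subseteq> {1..d}"
    by (auto simp: P_def)
  ultimately show ?thesis
    by blast
qed

lemma ideal_power: "ideal (I [^]\<^bsub>ideals_set (R_poly d)\<^esub> (n::nat)) (R_poly d)"
proof (induction n)
  case 0
  then show ?case
    by (simp add: nat_pow_def ideals_set_def R.oneideal)
next
  case (Suc n)
  then show ?case
    using R.ideal_prod_is_ideal[OF Suc ideal_I] by (simp add: nat_pow_def ideals_set_def)
qed

text \<open>Weights add under multiplication, so each further factor from \<open>I\<close> raises
  the weight by at least one.\<close>

lemma power_subset_weight_ideal:
  assumes "I \<subseteq> weight_ideal d P 1"
  shows "I [^]\<^bsub>ideals_set (R_poly d)\<^esub> (n::nat) \<subseteq> weight_ideal d P n"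
proof (induction n)
  case 0
  have "exponents 1 {1..d} \<subseteq> {a \<in> exponents 1 {1..d}. 0 \<le> weight P a}"
    by (auto simp: weight_nonneg)
  then show ?case
    using supported_mono by (auto simp: nat_pow_def ideals_set_def weight_ideal_def root_poly_ring_eq)
next
  case (Suc n)
  have "f * g \<in> weight_ideal d P (Suc n)"
    if "f \<in> weight_ideal d P n" "g \<in> weight_ideal d P 1" for f g :: "'k frac_poly"
    using that unfolding weight_ideal_def
    by (rule mult_in_supported) (auto simp: exponents_add weight_add)
  moreover have "x \<in> weight_ideal d P (Suc n)"
    if "x \<in> (I [^]\<^bsub>ideals_set (R_poly d)\<^esub> n) \<cdot>\<^bsub>R_poly d\<^esub> I" for x
    using that
  proof (induction x rule: ideal_prod.induct)
    case (prod i j)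
    then show ?case
      using Suc assms calculation by (auto simp: root_poly_ring_eq)
  next
    case (sum s1 s2)
    then show ?case
      by (auto simp: root_poly_ring_eq weight_ideal_def intro: add_in_supported)
  qed
  ultimately show ?case
    by (auto simp: nat_pow_def ideals_set_def)
qed

text \<open>For the inclusion from right to left, let \<open>y\<close> be the product of the variables outside \<open>P\<close>.
  By minimality of \<open>P\<close>, each variable \<open>x\<^sub>i\<close> with \<open>i \<in> P\<close> has a generator of \<open>I\<close> that involves no other
  variable of \<open>P\<close> and hence divides \<open>x\<^sub>i y\<close>.\<close>

lemma local_contraction_power:
  assumes P: "P \<subseteq> {1..d}" and min: "weight_ideal d P 1 \<in> minimal_primes (R_poly d) I"
  shows "local_contraction (carrier (R_poly d)) (weight_ideal d P 1)
           (I [^]\<^bsub>ideals_set (R_poly d)\<^esub> (n::nat)) = weight_ideal d P n"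
proof
  let ?X = "exponents 1 {1..d}"
  have R: "R_poly d = ring_of_type_algebra\<lparr>carrier := supported ?X\<rparr>"
    by (simp only: root_poly_ring_eq monoid_algebra_def)
  have I_sub: "I \<subseteq> weight_ideal d P 1"
    using min by (simp add: minimal_primes_def)
  have "local_contraction (supported ?X) (weight_ideal d P 1)
           (I [^]\<^bsub>ideals_set (R_poly d)\<^esub> n) \<subseteq> weight_ideal d P n"
  proof (rule local_contraction_subset)
    show "f \<in> weight_ideal d P n"
      if "f \<in> supported ?X" "s \<in> supported ?X - weight_ideal d P 1" "f * s \<in> weight_ideal d P n"
      for f s :: "'k frac_poly"
      using weight_ideal_mult_cancel[of f d s P n] that by auto
  qed (use primeideal_weight_ideal[of d P] ideal_weight_ideal[of d P n]
        power_subset_weight_ideal[OF I_sub] in \<open>simp_all add: R\<close>)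
  then show "local_contraction (carrier (R_poly d)) (weight_ideal d P 1)
           (I [^]\<^bsub>ideals_set (R_poly d)\<^esub> n) \<subseteq> weight_ideal d P n"
    by (simp add: root_poly_ring_eq)

  have fin: "finite P"
    using P finite_subset by blast
  define y where "y = (\<Sum>j\<in>{1..d} - P. single j (1 :: rat))"
  have y_lookup: "lookup y j = (if j \<in> {1..d} - P then 1 else 0)" for j
    by (simp add: y_def lookup_sum lookup_single when_def)
  have y: "y \<in> ?X" "weight P y = 0"
    by (auto simp: exponents_def y_lookup in_keys_iff weight_def split: if_splits)
  \<comment> \<open>Powers of the monomial of \<open>y\<close> have weight 0, which makes them
    available as denominators outside the prime.\<close>
  have y_pow: "(monomial y ^ n :: 'k frac_poly) \<in> supported {a \<in> ?X. weight P a = 0}" for n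
  proof (induction n)
    case 0
    then show ?case
      by (auto intro: one_in_supported simp: exponents_def weight_def)
  next
    case (Suc n)
    have "(monomial y :: 'k frac_poly) \<in> supported {a \<in> ?X. weight P a = 0}"
      using y by simp
    from mult_in_supported[OF this Suc] show ?case
      by (auto simp: exponents_add weight_add)
  qed

  have xy: "monomial (single i 1) * monomial y \<in> I" if i: "i \<in> P" for i
  proof -
    \<comment> \<open>The prime of \<open>P - {i}\<close> lies inside that of \<open>P\<close>. If
      it contained \<open>I\<close>, minimality would force equality, but the variable with index
      \<open>i\<close> lies in only one of the two.\<close>
    have "\<not> I \<subseteq> weight_ideal d (P - {i}) 1"
    proof
      assume sub: "I \<subseteq> weight_ideal d (P - {i}) 1"
      have "weight (P - {i}) a \<le> weight P a" if "a \<in> ?X" for a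
        unfolding weight_def using fin exponents_nonneg[OF that] by (intro sum_mono2) auto
      then have "weight_ideal d (P - {i}) 1 \<subseteq> (weight_ideal d P 1 :: 'k frac_poly set)"
        unfolding weight_ideal_def by (intro supported_mono) force
      from minimal_primes_minimal[OF min primeideal_weight_ideal sub this]
      have eq: "weight_ideal d (P - {i}) 1 = (weight_ideal d P 1 :: 'k frac_poly set)" .
      have "monomial (single i 1) \<in> (weight_ideal d P 1 :: 'k frac_poly set)"
        using i P fin by (auto simp: weight_ideal_def weight_single intro!: single_in_exponents)
      moreover have "monomial (single i 1) \<notin> (weight_ideal d (P - {i}) 1 :: 'k frac_poly set)"
        using fin by (simp add: weight_ideal_def weight_single)
      ultimately show False
        using eq by simp
    qed
    moreover have "I \<subseteq> weight_ideal d (P - {i}) 1" if "\<forall>e\<in>E. \<exists>j\<in>P - {i}. lookup e j = 1"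
      using that P by (intro I_subset_weight_ideal) auto
    \<comment> \<open>Since \<open>P - {i}\<close> is not a vertex cover, some generator avoids all
      variables of \<open>P\<close> except possibly the one with index \<open>i\<close>.\<close>
    ultimately obtain e where e: "e \<in> E" "\<forall>j\<in>P - {i}. lookup e j \<noteq> 1"
      by blast
    \<comment> \<open>The exponents of \<open>e\<close> are at most 1 at \<open>i\<close> and
      outside \<open>P\<close>, and 0 at the other indices of \<open>P\<close>, so \<open>e\<close>
      divides the product of the variable with \<open>y\<close>.\<close>
    have "single i 1 + y - e \<in> ?X"
    proof (rule exponents_diff)
      show "single i 1 + y \<in> ?X"
        using i P y by (auto intro: exponents_add single_in_exponents)
      show "e \<in> ?X"
        using e E_exponents by auto
      show "lookup e j \<le> lookup (single i 1 + y) j" for j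
        using E_01[OF e(1), of j] E_keys[OF e(1)] e(2) i
        by (auto simp: lookup_add lookup_single y_lookup when_def in_keys_iff subset_iff)
    qed
    then have "monomial (single i 1 + y - e) * monomial e \<in> I"
      using monomial_in_I[OF e(1)] by (intro ideal_R_polyD(4)[OF ideal_I]) auto
    then show ?thesis
      by (simp flip: monomial_add)
  qed

  \<comment> \<open>The induction takes one variable of \<open>P\<close> off the monomial and pairs
    it with one factor \<open>y\<close>; by \<open>xy\<close> each such pair lies in
    \<open>I\<close>.\<close>
  have single: "single a c * monomial y ^ n \<in> I [^]\<^bsub>ideals_set (R_poly d)\<^esub> n"
    if "a \<in> ?X" "of_nat n \<le> weight P a" for a c n
    using that
  proof (induction n arbitrary: a)
    case 0
    then show ?case
      by (simp add: nat_pow_def ideals_set_def root_poly_ring_eq single_in_supported)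
  next
    case (Suc n)
    have "0 < weight P a"
      using Suc.prems(2) by simp
    then obtain i where i: "i \<in> P" "lookup a i > 0"
      by (metis not_le sum_nonpos weight_def)
    have "single i 1 \<in> ?X"
      using i(1) P by (intro single_in_exponents) auto
    moreover have "1 \<le> lookup a i"
      using Suc.prems(1) i(2) by (auto simp: exponents_def elim!: allE[of _ i] Nats_cases)
    ultimately have "a - single i 1 \<in> ?X"
      using Suc.prems(1) exponents_nonneg[OF Suc.prems(1)]
      by (intro exponents_diff) (auto simp: lookup_single when_def)
    moreover have "weight P a = weight P (a - single i 1) + 1"
      using weight_add[of P "a - single i 1" "single i 1"] i(1) fin by (simp add: weight_single)
    ultimately have "single (a - single i 1) c * monomial y ^ n \<in> I [^]\<^bsub>ideals_set (R_poly d)\<^esub> n"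
      using Suc by simp
    then have "single (a - single i 1) c * monomial y ^ n * (monomial (single i 1) * monomial y)
        \<in> I [^]\<^bsub>ideals_set (R_poly d)\<^esub> Suc n"
      using ideal_prod.prod[OF _ xy[OF i(1)], of _ _ "R_poly d"]
      by (simp add: nat_pow_def ideals_set_def root_poly_ring_eq)
    moreover have "single (a - single i 1) c * monomial y ^ n * (monomial (single i 1) * monomial y)
        = single a c * monomial y ^ Suc n"
    proof -
      have "single a c = single (a - single i 1) c * monomial (single i 1)"
        by (simp add: monomial_def mult_single)
      then show ?thesis
        by (simp add: mult_ac)
    qed
    ultimately show ?case
      by simp
  qed

  show "weight_ideal d P n \<subseteq> local_contraction (carrier (R_poly d)) (weight_ideal d P 1)
           (I [^]\<^bsub>ideals_set (R_poly d)\<^esub> n)"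
  proof
    fix f :: "'k frac_poly"
    assume f: "f \<in> weight_ideal d P n"
    have "(\<Sum>a\<in>keys f. single a (lookup f a) * monomial y ^ n) \<in> I [^]\<^bsub>ideals_set (R_poly d)\<^esub> n"
      using f by (intro ideal_R_poly_sum[OF ideal_power] single)
        (auto simp: weight_ideal_def supported_def)
    then have "f * monomial y ^ n \<in> I [^]\<^bsub>ideals_set (R_poly d)\<^esub> n"
      by (simp add: sum_single flip: sum_distrib_right)
    moreover have "monomial y ^ n \<noteq> (0 :: 'k frac_poly)"
      by (metis monomial_nonzero power_not_zero)
    then obtain c where c: "c \<in> keys (monomial y ^ n :: 'k frac_poly)"
      by (metis ex_in_conv in_keys_iff lookup_zero poly_mapping_eqI)
    then have "weight P c = 0"
      using y_pow[of n] unfolding supported_def by blast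
    then have "monomial y ^ n \<notin> (weight_ideal d P 1 :: 'k frac_poly set)"
      using c unfolding supported_def weight_ideal_def by force
    moreover have "(monomial y ^ n :: 'k frac_poly) \<in> supported ?X"
      using y_pow[of n] unfolding supported_def by blast
    ultimately show "f \<in> local_contraction (carrier (R_poly d)) (weight_ideal d P 1)
           (I [^]\<^bsub>ideals_set (R_poly d)\<^esub> n)"
      using subsetD[OF weight_ideal_subset f] ideal_R_polyD(2)[OF ideal_weight_ideal]
      by (intro in_local_contraction[of f _ "monomial y ^ n"])
        (simp_all add: root_poly_ring_eq one_in_supported zero_in_exponents)
  qed
qed

end

section \<open>Exponents of the symbolic Rees algebra\<close>

text \<open>A monomial with exponent \<open>a\<close> is the \<open>m\<close>-th root of one of
  weight \<open>of_nat m * weight P a\<close>, which explains the factor. With \<P> listing the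
  variable sets of the minimal primes, these are the exponents of (I^(n))^(1/m).\<close>

definition symbolic_exponents :: "nat \<Rightarrow> nat \<Rightarrow> nat set set \<Rightarrow> nat \<Rightarrow> (nat \<Rightarrow>\<^sub>0 rat) set" where
  "symbolic_exponents m d \<P> n =
     {a \<in> exponents m {1..d}. \<forall>P\<in>\<P>. of_nat n \<le> of_nat m * weight P a}"

text \<open>The exponent at index \<open>0\<close> is that of \<open>t\<close>, so \<open>c = 0\<close> describes \<open>\<R>\<^sup>s(I)\<^sup>1\<^sup>/\<^sup>m\<close> and \<open>c = 1\<close> describes
  \<open>\<J>\<^sup>s(I)\<^sup>1\<^sup>/\<^sup>m\<close>.\<close>

definition rees_exponents :: "nat \<Rightarrow> nat \<Rightarrow> nat set set \<Rightarrow> nat \<Rightarrow> (nat \<Rightarrow>\<^sub>0 rat) set" where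
  "rees_exponents m d \<P> c =
     {a \<in> exponents m {0..d}. \<forall>P\<in>\<P>. of_nat m * lookup a 0 + of_nat c \<le> of_nat m * weight P a}"

text \<open>Each minimal prime contributes one weight bound, and the intersection imposes them all.
  The same family serves every \<open>n\<close>, which allows the degrees to be assembled
  afterwards.\<close>

lemma (in squarefree_ideal) symbolic_power_eq:
  "\<exists>\<P> \<subseteq> Pow {1..d}. \<forall>n. symbolic_power d I n = supported (symbolic_exponents 1 d \<P> n)"
proof -
  have "minimal_primes (R_poly d) I \<subseteq> (\<lambda>P. weight_ideal d P 1) ` Pow {1..d}"
    using minimal_primes_eq_weight_ideal by blast
  then obtain \<P> where \<P>: "\<P> \<subseteq> Pow {1..d}"
    and minimal_primes: "minimal_primes (R_poly d) I = (\<lambda>P. weight_ideal d P 1) ` \<P>"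
    by (auto simp: subset_image_iff)
  have "symbolic_power d I n = supported (symbolic_exponents 1 d \<P> n)" for n
  proof (cases "n = 0")
    \<comment> \<open>The power of index 0 is the whole ring by definition, and the bound 0 holds
      for all exponents because weights are nonnegative.\<close>
    case True
    then show ?thesis
      using weight_nonneg[of _ 1 "{1..d}"]
      by (auto simp: symbolic_power_def symbolic_exponents_def root_poly_ring_eq supported_def)
  next
    case False
    have "symbolic_power d I n = supported (exponents 1 {1..d}) \<inter>
        (\<Inter>P\<in>\<P>. local_contraction (carrier (R_poly d)) (weight_ideal d P 1)
          (I [^]\<^bsub>ideals_set (R_poly d)\<^esub> n))"
      using False by (simp add: symbolic_power_def minimal_primes) (simp add: root_poly_ring_eq)
    also have "\<dots> = supported (exponents 1 {1..d}) \<inter> (\<Inter>P\<in>\<P>. weight_ideal d P n)"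
      using local_contraction_power \<P> minimal_primes
      by (intro arg_cong2[of _ _ _ _ "(\<inter>)"] INF_cong) auto
    also have "\<dots> = supported (symbolic_exponents 1 d \<P> n)"
      by (auto simp: symbolic_exponents_def weight_ideal_def supported_def subset_iff)
    finally show ?thesis .
  qed
  with \<P> show ?thesis
    by blast
qed

lemma weight_scale: "(\<And>i. lookup b i = c * lookup a i) \<Longrightarrow> weight P b = c * weight P a"
  by (simp add: weight_def sum_distrib_left)

lemma lookup_map_zero: "f 0 = 0 \<Longrightarrow> lookup (Poly_Mapping.map f a) i = f (lookup a i)"
  by (simp add: Poly_Mapping.map.rep_eq when_def)

lemma keys_map_subset: "keys (Poly_Mapping.map f a) \<subseteq> keys a"
  by (auto simp: in_keys_iff Poly_Mapping.map.rep_eq)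

lemma monoid_ideal_symbolic_exponents:
  "m > 0 \<Longrightarrow> monoid_ideal (symbolic_exponents m d \<P> n) (exponents m {1..d})"
  using weight_nonneg[of _ m "{1..d}"]
  by (auto simp: monoid_ideal_def symbolic_exponents_def exponents_add weight_add distrib_left
      intro: add_increasing)

text \<open>Scaling by \<open>m\<close> and by its inverse are mutually inverse bijections between
  the exponents for \<open>m\<close> and those for 1, so the roots of the monomials already include
  every monomial of the right-hand side.\<close>

lemma ideal_root_supported:
  assumes "m > 0"
  shows "ideal_root d m (supported (symbolic_exponents 1 d \<P> n) :: 'k::field frac_poly set) =
    supported (symbolic_exponents m d \<P> n)"
proof
  let ?R = "R_root d m :: 'k frac_poly ring"
  let ?G = "{monomial (Poly_Mapping.map (\<lambda>q. q / of_nat m) a) |a.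
      (monomial a :: 'k frac_poly) \<in> supported (symbolic_exponents 1 d \<P> n)} :: 'k frac_poly set"
  interpret ring ?R
    unfolding root_poly_ring_eq by (intro cring.axioms(1) cring_monoid_algebra submonoid_exponents)
  have gen: "?G \<subseteq> supported (symbolic_exponents m d \<P> n)"
  proof safe
    fix a
    assume "(monomial a :: 'k frac_poly) \<in> supported (symbolic_exponents 1 d \<P> n)"
    then have a: "a \<in> exponents 1 {1..d}" "\<forall>P\<in>\<P>. of_nat n \<le> weight P a"
      by (simp_all add: symbolic_exponents_def)
    let ?b = "Poly_Mapping.map (\<lambda>q. q / of_nat m) a"
    have "weight P ?b = weight P a / of_nat m" for P
      using weight_scale[of ?b "1 / of_nat m" a P] by (simp add: lookup_map_zero)
    then have "?b \<in> symbolic_exponents m d \<P> n"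
      using a assms keys_map_subset[of "\<lambda>q. q / of_nat m" a]
      by (auto simp: symbolic_exponents_def exponents_def lookup_map_zero)
    then show "(monomial ?b :: 'k frac_poly) \<in> supported (symbolic_exponents m d \<P> n)"
      by simp
  qed
  have "ideal (supported (symbolic_exponents m d \<P> n)) ?R"
    unfolding root_poly_ring_eq
    using submonoid_exponents monoid_ideal_symbolic_exponents[OF assms] by (rule ideal_monoid_algebra)
  then show "ideal_root d m (supported (symbolic_exponents 1 d \<P> n)) \<subseteq>
      (supported (symbolic_exponents m d \<P> n) :: 'k frac_poly set)"
    unfolding ideal_root_def using gen by (rule genideal_minimal)
  have "?G \<subseteq> carrier ?R"
    using gen supported_mono[of "symbolic_exponents m d \<P> n" "exponents m {1..d}"]
    by (auto simp: root_poly_ring_eq symbolic_exponents_def)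
  then have J: "ideal (genideal ?R ?G) ?R" "?G \<subseteq> genideal ?R ?G"
    by (rule genideal_ideal, rule genideal_self)
  note J' = J(1)[unfolded root_poly_ring_eq monoid_algebra_def]
  show "(supported (symbolic_exponents m d \<P> n) :: 'k frac_poly set) \<subseteq>
      ideal_root d m (supported (symbolic_exponents 1 d \<P> n))"
  proof
    fix f :: "'k frac_poly"
    assume f: "f \<in> supported (symbolic_exponents m d \<P> n)"
    have "single b (lookup f b) \<in> genideal ?R ?G" if "b \<in> keys f" for b
    proof -
      have b: "b \<in> exponents m {1..d}" "\<forall>P\<in>\<P>. of_nat n \<le> of_nat m * weight P b"
        using f that by (auto simp: supported_def symbolic_exponents_def)
      \<comment> \<open>This is the exponent of the \<open>m\<close>-th power of the monomial, so
        that \<open>b\<close> is the root of a monomial in the given ideal.\<close>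
      let ?a = "Poly_Mapping.map (\<lambda>q. of_nat m * q) b"
      have "weight P ?a = of_nat m * weight P b" for P
        by (rule weight_scale) (simp add: lookup_map_zero)
      then have "?a \<in> symbolic_exponents 1 d \<P> n"
        using b keys_map_subset[of "\<lambda>q. of_nat m * q" b]
        by (auto simp: symbolic_exponents_def exponents_def lookup_map_zero)
      moreover have "Poly_Mapping.map (\<lambda>q. q / of_nat m) ?a = b"
        using assms by (intro poly_mapping_eqI) (simp add: lookup_map_zero)
      ultimately have "monomial b \<in> genideal ?R ?G"
        using J(2) by (force intro!: exI[of _ ?a])
      moreover have "single 0 (lookup f b) \<in> supported (exponents m {1..d})"
        by (simp add: single_in_supported zero_in_exponents)
      ultimately have "single 0 (lookup f b) * monomial b \<in> genideal ?R ?G"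
        using idealD_of_type_algebra(4)[OF J'] by (simp add: root_poly_ring_eq monoid_algebra_def)
      then show ?thesis
        by (simp flip: single_eq_monomial)
    qed
    then show "f \<in> ideal_root d m (supported (symbolic_exponents 1 d \<P> n))"
      using ideal_sum_of_type_algebra[OF J', of "keys f" "\<lambda>b. single b (lookup f b)"]
      by (simp add: sum_single ideal_root_def root_poly_ring_eq monoid_algebra_def)
  qed
qed

text \<open>Multiplying a monomial free of t by t^(n/m) writes \<open>n / m\<close> into coordinate
  0 and leaves the weights unchanged. The bound \<open>n + c\<close> of degree \<open>n\<close>
  thereby becomes a condition on the single exponent vector.\<close>

lemma graded_sum_supported:
  assumes "m > 0" "\<P> \<subseteq> Pow {1..d}"
  shows "graded_sum m (\<lambda>n. supported (symbolic_exponents m d \<P> (n + c)) :: 'k::field frac_poly set) =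
    supported (rees_exponents m d \<P> c)"
proof (intro equalityI subsetI)
  have weight_0: "weight P (single 0 q) = 0" if "P \<in> \<P>" for P q
  proof -
    have "P \<subseteq> {1..d}"
      using assms(2) that by auto
    moreover from this have "finite P"
      using finite_subset by blast
    ultimately show ?thesis
      by (auto simp: weight_single)
  qed
  {
    fix x :: "'k frac_poly"
    assume "x \<in> graded_sum m (\<lambda>n. supported (symbolic_exponents m d \<P> (n + c)))"
    then obtain f N where x: "x = (\<Sum>n<N. f n * t_pow (of_nat n / of_nat m))"
      and f: "\<And>n. n < N \<Longrightarrow> f n \<in> supported (symbolic_exponents m d \<P> (n + c))"
      by (auto simp: graded_sum_def)
    have "f n * t_pow (of_nat n / of_nat m) \<in> supported (rees_exponents m d \<P> c)" if "n < N" for n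
    proof (rule mult_in_supported[OF f[OF that]])
      let ?t = "single 0 (of_nat n / of_nat m) :: nat \<Rightarrow>\<^sub>0 rat"
      show "t_pow (of_nat n / of_nat m) \<in> supported {?t}"
        by (simp add: t_pow_def)
      fix a b
      assume a: "a \<in> symbolic_exponents m d \<P> (n + c)" and b: "b \<in> {?t}"
      have "lookup a 0 = 0"
        using a by (force simp: symbolic_exponents_def exponents_def in_keys_iff)
      moreover have "a \<in> exponents m {0..d}"
        using a by (auto simp: symbolic_exponents_def exponents_def)
      moreover have "?t \<in> exponents m {0..d}"
        using assms(1) by (auto simp: exponents_def lookup_single when_def)
      ultimately show "a + b \<in> rees_exponents m d \<P> c"
        using a b assms(1) weight_0
        by (auto simp: rees_exponents_def symbolic_exponents_def exponents_add weight_add lookup_add)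
    qed
    then show "x \<in> supported (rees_exponents m d \<P> c)"
      unfolding x by (intro sum_in_supported) auto
  next
    fix f :: "'k frac_poly"
    assume f: "f \<in> supported (rees_exponents m d \<P> c)"
    \<comment> \<open>The degree of a term in the graded sum is \<open>m\<close> times its exponent
      of t, a natural number for the exponents that occur.\<close>
    define deg where "deg a = nat \<lfloor>of_nat m * lookup a 0\<rfloor>" for a :: "nat \<Rightarrow>\<^sub>0 rat"
    have deg: "of_nat (deg a) = of_nat m * lookup a 0" if "a \<in> keys f" for a
    proof -
      have "of_nat m * lookup a 0 \<in> \<nat>"
        using f that by (auto simp: supported_def rees_exponents_def exponents_def)
      then show ?thesis
        unfolding deg_def by (auto elim!: Nats_cases)
    qed
    \<comment> \<open>The sum of the degrees bounds each of them, so \<open>N\<close> exceeds every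
      degree that occurs.\<close>
    define N where "N = Suc (\<Sum>a\<in>keys f. deg a)"
    have N: "deg a < N" if "a \<in> keys f" for a
      using member_le_sum[of a "keys f" deg] that by (simp add: N_def)
    \<comment> \<open>The terms of degree \<open>n\<close> are collected and stripped of their power
      of t.\<close>
    define F where "F n = (\<Sum>a\<in>{a \<in> keys f. deg a = n}.
        single (a - single 0 (of_nat n / of_nat m)) (lookup f a))" for n
    have F: "F n \<in> supported (symbolic_exponents m d \<P> (n + c))" for n
      unfolding F_def
    proof (intro sum_in_supported single_in_supported)
      fix a
      assume a: "a \<in> {a \<in> keys f. deg a = n}"
      let ?b = "a - single 0 (of_nat n / of_nat m)"
      have a_rees: "a \<in> rees_exponents m d \<P> c"
        using a f by (auto simp: supported_def)
      have n: "of_nat n = of_nat m * lookup a 0"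
        using deg[of a] a by simp
      have lookup_b: "lookup ?b i = (if i = 0 then 0 else lookup a i)" for i
        using n assms(1) by (simp add: lookup_minus lookup_single)
      have "?b \<in> exponents m {1..d}"
      proof -
        have "i \<in> {1..d}" if "i \<in> keys ?b" for i
        proof -
          have "i \<in> keys a" "i \<noteq> 0"
            using that by (auto simp: in_keys_iff lookup_b split: if_splits)
          then show ?thesis
            using a_rees by (force simp: rees_exponents_def exponents_def)
        qed
        then show ?thesis
          using a_rees by (auto simp: exponents_def rees_exponents_def lookup_b)
      qed
      moreover have "weight P ?b = weight P a" if "P \<in> \<P>" for P
        using weight_add[of P ?b "single 0 (of_nat n / of_nat m)"] weight_0[OF that] by simp
      ultimately show "?b \<in> symbolic_exponents m d \<P> (n + c)"
        using a_rees n by (simp add: symbolic_exponents_def rees_exponents_def)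
    qed
    have "F n * t_pow (of_nat n / of_nat m) =
        (\<Sum>a\<in>{a \<in> keys f. deg a = n}. single a (lookup f a))" for n
      by (simp add: F_def sum_distrib_right t_pow_def monomial_def mult_single)
    then have "f = (\<Sum>n<N. F n * t_pow (of_nat n / of_nat m))"
      using sum.group[of "keys f" "{..<N}" deg "\<lambda>a. single a (lookup f a)"] N
      by (simp add: sum_single image_subset_iff)
    with F show "f \<in> graded_sum m (\<lambda>n. supported (symbolic_exponents m d \<P> (n + c)))"
      unfolding graded_sum_def mem_Collect_eq by (intro exI conjI allI impI)
  }
qed

section \<open>Comparison of the exponents with those for rings of \<open>m\<close>-roots\<close>

lemma rees_exponents_subset: "rees_exponents m d \<P> c \<subseteq> exponents m {0..d}"
  by (auto simp: rees_exponents_def)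

lemma submonoid_rees_exponents: "submonoid_of_type (rees_exponents m d \<P> 0)"
  by (auto simp: submonoid_of_type_def rees_exponents_def exponents_add zero_in_exponents weight_add
      lookup_add distrib_left add_mono) (simp add: weight_def)

lemma monoid_ideal_rees_exponents: "monoid_ideal (rees_exponents m d \<P> c) (rees_exponents m d \<P> 0)"
proof -
  have "of_nat m * (p + q) + of_nat c \<le> of_nat m * (v + w)"
    if "of_nat m * p \<le> of_nat m * v" "of_nat m * q + of_nat c \<le> of_nat m * w" for p q v w :: rat
    using add_mono[OF that] by (simp add: distrib_left)
  then show ?thesis
    by (auto simp: monoid_ideal_def rees_exponents_def exponents_add weight_add lookup_add)
qed

text \<open>The inequality is multiplied by \<open>m\<close>, and \<open>m * c\<close> is at least
  \<open>c\<close>. For \<open>c = 0\<close> this is the inclusion of I^(n) in (I^(nm))^(1/m), for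
  \<open>c = 1\<close> that of I^(n+1) in (I^(nm+1))^(1/m).\<close>

lemma rees_exponents_root:
  assumes "m > 0" "c \<le> 1"
  shows "rees_exponents 1 d \<P> c \<subseteq> rees_exponents m d \<P> c"
proof
  fix a
  assume a: "a \<in> rees_exponents 1 d \<P> c"
  have "of_nat m * lookup a 0 + of_nat c \<le> of_nat m * weight P a" if "P \<in> \<P>" for P
  proof -
    have "of_nat m * (lookup a 0 + of_nat c) \<le> of_nat m * weight P a"
      using a that by (intro mult_left_mono) (auto simp: rees_exponents_def)
    moreover have "(of_nat c :: rat) \<le> of_nat (m * c)"
      using assms(1) by (intro of_nat_mono) simp
    ultimately show ?thesis
      by (simp add: distrib_left)
  qed
  then show "a \<in> rees_exponents m d \<P> c"
    using a by (auto simp: rees_exponents_def exponents_def)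
qed

lemma rees_exponents_integral:
  assumes "m > 0" "c \<le> 1" "a \<in> rees_exponents m d \<P> c" "a \<in> exponents 1 {0..d}"
  shows "a \<in> rees_exponents 1 d \<P> c"
proof -
  have "lookup a 0 + of_nat c \<le> weight P a" if "P \<in> \<P>" for P
  proof -
    have *: "of_nat m * lookup a 0 + of_nat c \<le> of_nat m * weight P a"
      using assms(3) that by (auto simp: rees_exponents_def)
    have "lookup a 0 \<in> \<nat>" "weight P a \<in> \<nat>"
      using assms(4) weight_Nats[of a "{0..d}"] by (auto simp: exponents_def)
    then obtain u v where uv: "lookup a 0 = of_nat u" "weight P a = of_nat v"
      by (auto elim!: Nats_cases)
    from * have "of_nat (m * u + c) \<le> (of_nat (m * v) :: rat)"
      unfolding uv by simp
    then have le: "m * u + c \<le> m * v"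
      by (simp only: of_nat_le_iff)
    have "u + c \<le> v"
    proof (cases "c = 0")
      case True
      then show ?thesis
        using le assms(1) by simp
    next
      case False
      \<comment> \<open>Here the shift is 1: the strict inequality survives division by
        \<open>m\<close> and gains back exactly one between natural numbers.\<close>
      then have "m * u < m * v"
        using le by linarith
      then show ?thesis
        using assms(2) by simp
    qed
    then show ?thesis
      unfolding uv by (simp flip: of_nat_add)
  qed
  then show ?thesis
    using assms(4) by (simp add: rees_exponents_def)
qed

text \<open>The difference of the integral vectors \<open>a + b\<close> and \<open>a\<close> is
  integral, and \<open>b\<close> is nonnegative, so its entries are natural numbers; the weight
  conditions then descend from \<open>m\<close> to 1.\<close>

lemma rees_exponents_cancel:
  assumes "m > 0" "a \<in> rees_exponents 1 d \<P> 0" "b \<in> rees_exponents m d \<P> 0"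
    and "a + b \<in> rees_exponents 1 d \<P> 0"
  shows "b \<in> rees_exponents 1 d \<P> 0"
proof (rule rees_exponents_integral[OF assms(1) _ assms(3)])
  have b: "b \<in> exponents m {0..d}"
    using assms(3) subsetD[OF rees_exponents_subset] by blast
  have "lookup b i \<in> \<nat>" for i
  proof -
    have "lookup (a + b) i \<in> \<nat>" "lookup a i \<in> \<nat>"
      using assms(2,4) by (auto simp: rees_exponents_def exponents_def)
    then have "lookup (a + b) i - lookup a i \<in> \<int>"
      using Nats_subset_Ints by (intro Ints_diff) auto
    then show ?thesis
      using exponents_nonneg[OF b assms(1), of i] by (simp add: lookup_add Nats_altdef2)
  qed
  then show "b \<in> exponents 1 {0..d}"
    using b by (simp add: exponents_def)
qed simp

theorem theorem4p3:
  fixes I :: "'k::field frac_poly set" and d m :: nat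
  assumes "squarefree_monomial_ideal d I" and "m > 0"
  shows "ring_map_splits (sym_rees d I) (sym_rees_root d m I) sym_rees_map
       \<and> ring_map_splits (sym_gr d I) (sym_gr_root d m I) (sym_gr_map d m I)"
proof -
  obtain E where "\<forall>a\<in>E. keys a \<subseteq> {1..d} \<and> (\<forall>i. lookup a i \<in> {0, 1})"
    "I = genideal (R_poly d) (monomial ` E)"
    using assms(1) unfolding squarefree_monomial_ideal_def by (elim exE conjE)
  then have "squarefree_ideal d E I"
    by (intro squarefree_ideal.intro) auto
  then obtain \<P> where \<P>: "\<P> \<subseteq> Pow {1..d}"
    and "\<forall>n. symbolic_power d I n = supported (symbolic_exponents 1 d \<P> n)"
    by (elim squarefree_ideal.symbolic_power_eq[elim_format] exE conjE)
  then have sym: "symbolic_power d I = (\<lambda>n. supported (symbolic_exponents 1 d \<P> n))"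
    by auto
  have root: "ideal_root d m (symbolic_power d I n) = supported (symbolic_exponents m d \<P> n)" for n
    unfolding sym by (rule ideal_root_supported[OF assms(2)])
  \<comment> \<open>\<open>?A\<close> and \<open>?B\<close> carry the two Rees algebras,
    \<open>?J\<close> and \<open>?K\<close> the ideals by which they are divided.\<close>
  let ?A = "rees_exponents 1 d \<P> 0" and ?B = "rees_exponents m d \<P> 0"
  let ?J = "rees_exponents 1 d \<P> 1" and ?K = "rees_exponents m d \<P> 1"
  have rees: "sym_rees d I = monoid_algebra ?A"
    using graded_sum_supported[OF zero_less_one \<P>, of 0, where ?'k = 'k]
    by (simp add: sym_rees_def sym root_poly_ring_def monoid_algebra_def)
  have rees_root: "sym_rees_root d m I = monoid_algebra ?B"
    using graded_sum_supported[OF assms(2) \<P>, of 0, where ?'k = 'k]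
    by (simp add: sym_rees_root_def root root_poly_ring_def monoid_algebra_def)
  have J: "sym_J d I = supported ?J"
    using graded_sum_supported[OF zero_less_one \<P>, of 1, where ?'k = 'k]
    by (simp only: sym_J_def sym)
  have J_root: "sym_J_root d m I = supported ?K"
    using graded_sum_supported[OF assms(2) \<P>, of 1, where ?'k = 'k]
    by (simp only: sym_J_root_def root)
  have AB: "?A \<subseteq> ?B" "?J \<subseteq> ?K"
    using rees_exponents_root[OF assms(2)] by auto
  \<comment> \<open>Here the rounding with shift 1 enters: it makes the truncation well defined on
    the associated graded rings.\<close>
  have KA: "?K \<inter> ?A \<subseteq> ?J"
    using rees_exponents_integral[OF assms(2)] rees_exponents_subset by blast
  have cancel: "b \<in> ?A" if "a \<in> ?A" "b \<in> ?B" "a + b \<in> ?A" for a b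
    using rees_exponents_cancel[OF assms(2) that] .
  show ?thesis
    unfolding sym_gr_def sym_gr_root_def sym_gr_map_def[abs_def] sym_rees_map_def[abs_def]
      rees rees_root J J_root
    by (rule conjI, rule monoid_algebra_retract[OF submonoid_rees_exponents submonoid_rees_exponents
          AB(1)], erule (2) cancel, rule monoid_algebra_Quot_retract[OF submonoid_rees_exponents
          submonoid_rees_exponents AB(1) monoid_ideal_rees_exponents monoid_ideal_rees_exponents
          AB(2) KA], erule (2) cancel)
qed

end
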